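(* Consider $$-\left(\varphi_p(u')\right)'+q(x)\varphi_p(u)=\lambda m(x)f(u),\quad 0<x<T,\qquad u(0)=u(T),\ u'(0)=u'(T),\qquad (N)$$ where $f\in C(\mathbb{R},\mathbb{R})$ satisfies $f(s)s>0$ for $s\neq0$. If $f_0=0$ and $f_\infty=0$, then there exist $\lambda_+^+>0$ and $\lambda_-^+<0$ such that for any $\lambda\in(\lambda_+^+,+\infty)\cup(-\infty,\lambda_-^+)$, problem (N) has two positive solutions $u_1^+$ and $u_2^+$ on $[0,T]$. Similarly, there exist $\lambda_+^->0$ and $\lambda_-^-<0$ such that for any $\lambda\in(\lambda_+^-,+\infty)\cup(-\infty,\lambda_-^-)$, problem (N) has two negative solutions $u_1^-$ and $u_2^-$ on $[0,T]$. Moreover, for $\nu\in\{+,-\}$ there exists $\mu_*^\nu>0$ such that problem (N) has no one-sign solutions for any $\lambda\in(0,\mu_*^\nu)$.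
   Context: Here $T>0$, $1<p<+\infty$, $\varphi_p(s)=|s|^{p-2}s$ (with $\varphi_p(0)=0$), $q\in C([0,T];[0,+\infty))$ with $q\not\equiv0$, and $m:[0,T]\to\mathbb{R}$ is a continuous sign-changing weight (it takes both positive and negative values). $f_0=\lim_{|s|\to0}f(s)/\varphi_p(s)$ and $f_\infty=\lim_{|s|\to+\infty}f(s)/\varphi_p(s)$ (assumed to exist). Solutions are classical. A one-sign solution is a solution that is positive on $[0,T]$ or negative on $[0,T]$. The two positive (respectively negative) solutions are distinct. *)

theory Defs
  imports "HOL-Analysis.Analysis"
begin

definition phi :: "real \<Rightarrow> real \<Rightarrow> real" where
  "phi p s = \<bar>s\<bar> powr (p - 2) * s"

text \<open>
  Classical solutions of
  \<open>-(phi p u')' + q phi p u = lam m f(u)\<close> on \<open>(0, T)\<close>, \<open>u(0) = u(T)\<close>, \<open>u'(0) = u'(T)\<close>.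
  The function \<open>v\<close> is the derivative \<open>u'\<close>, one-sided at the end points, so that \<open>u\<close> is of
  class \<open>C\<^sup>1\<close> on \<open>[0, T]\<close>. The flux \<open>phi p u'\<close> is differentiable on \<open>(0, T)\<close>, where the
  equation determines its derivative as a continuous function. Only the values of \<open>u\<close>
  on \<open>[0, T]\<close> matter.
\<close>

definition periodic_solution ::
  "real \<Rightarrow> real \<Rightarrow> (real \<Rightarrow> real) \<Rightarrow> (real \<Rightarrow> real) \<Rightarrow> (real \<Rightarrow> real) \<Rightarrow> real \<Rightarrow> (real \<Rightarrow> real) \<Rightarrow> bool"
where
  "periodic_solution T p q m f lam u \<longleftrightarrow>
    (\<exists>v. (\<forall>x\<in>{0..T}. (u has_real_derivative v x) (at x within {0..T})) \<and>
         continuous_on {0..T} v \<and>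
         (\<forall>x\<in>{0<..<T}. (\<lambda>t. phi p (v t)) differentiable (at x) \<and>
            - deriv (\<lambda>t. phi p (v t)) x + q x * phi p (u x) = lam * m x * f (u x)) \<and>
         u 0 = u T \<and> v 0 = v T)"

definition positive_solution ::
  "real \<Rightarrow> real \<Rightarrow> (real \<Rightarrow> real) \<Rightarrow> (real \<Rightarrow> real) \<Rightarrow> (real \<Rightarrow> real) \<Rightarrow> real \<Rightarrow> (real \<Rightarrow> real) \<Rightarrow> bool"
where
  "positive_solution T p q m f lam u \<longleftrightarrow>
    periodic_solution T p q m f lam u \<and> (\<forall>x\<in>{0..T}. u x > 0)"

definition negative_solution ::
  "real \<Rightarrow> real \<Rightarrow> (real \<Rightarrow> real) \<Rightarrow> (real \<Rightarrow> real) \<Rightarrow> (real \<Rightarrow> real) \<Rightarrow> real \<Rightarrow> (real \<Rightarrow> real) \<Rightarrow> bool"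
where
  "negative_solution T p q m f lam u \<longleftrightarrow>
    periodic_solution T p q m f lam u \<and> (\<forall>x\<in>{0..T}. u x < 0)"

definition one_sign_solution ::
  "real \<Rightarrow> real \<Rightarrow> (real \<Rightarrow> real) \<Rightarrow> (real \<Rightarrow> real) \<Rightarrow> (real \<Rightarrow> real) \<Rightarrow> real \<Rightarrow> (real \<Rightarrow> real) \<Rightarrow> bool"
where
  "one_sign_solution T p q m f lam u \<longleftrightarrow>
    positive_solution T p q m f lam u \<or> negative_solution T p q m f lam u"

end

theory Submission
  imports Defs "HOL-Complex_Analysis.Great_Picard"
begin

text \<open>
  By the reflections \<open>u \<mapsto> -u\<close> and \<open>(lam, m) \<mapsto> (-lam, -m)\<close> it suffices to find two positive solutions for
  large \<open>lam\<close> when \<open>m\<close> is positive somewhere. If \<open>e > 0\<close> is a periodic function with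
  \<open>-(phi p e')' + q phi p e \<ge> k > 0\<close>, then \<open>s e\<close> is a strict supersolution both for small and for large
  \<open>s\<close>, since \<open>f\<^sub>0 = f\<^sub>\<infinity> = 0\<close>; a bump supported where \<open>m > 0\<close> is a strict subsolution for large \<open>lam\<close>.
  One solution lies above the bump. A second one is neither below the small supersolution nor above
  the bump: otherwise, along a homotopy from a problem all of whose solutions are below the small
  supersolution to one all of whose solutions are above the bump, the two kinds of solutions would
  split the solution set into two closed pieces, which is impossible by Schauder's theorem with the
  homotopy parameter as an additional unknown. Both solutions are positive by a strong maximum
  principle. For small \<open>lam > 0\<close>, touching a positive solution from above by a multiple of \<open>e\<close> gives a
  contradiction. All comparisons take place at a maximum of a difference of two functions, where the
  derivatives of the fluxes are ordered.
\<close>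

section \<open>Schauder's fixed point theorem\<close>

text \<open>The zero function solves (N), so a fixed point alone proves nothing: what counts is its
  position relative to the barriers. Exceeding the small supersolution somewhere excludes zero;
  dropping below the bump somewhere separates the second solution from the first. Constants are
  annihilated by the periodic operator, so integrating the equation twice brings two solvability
  conditions: the right-hand side and \<open>u'\<close> must both have mean zero. The fixed-point
  map contains both, since the initial values of \<open>u\<close> and of the flux are shifted by the
  mean that ought to vanish. This is why a priori bounds are needed also for equations perturbed by
  a constant \<open>k\<close>. The barriers rest on homogeneity. A multiple \<open>s e\<close> gains
  \<open>phi p s * k\<close>, while the nonlinearity is small against \<open>phi p s\<close> for
  small and for large \<open>s\<close>; one function \<open>e\<close> therefore serves for both
  supersolutions and for nonexistence. As \<open>m\<close> changes sign, supersolutions are required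
  to beat \<open>\<bar>m x\<bar>\<close>, and the bump lives where \<open>m\<close> is
  positive.\<close>

text \<open>Kuhn's labelling argument, stopped at an approximate fixed point. The dimension
  \<open>n\<close> will be the size of a finite net found inside a proof, so points are functions on
  \<open>nat\<close> of which only the first \<open>n\<close> values count; \<open>unif\<close>
  makes \<open>g\<close> blind to the others.\<close>

lemma brouwer_cube_approx:
  fixes g :: "(nat \<Rightarrow> real) \<Rightarrow> nat \<Rightarrow> real"
  assumes range: "\<And>x i. \<lbrakk>\<And>j. j < n \<Longrightarrow> 0 \<le> x j \<and> x j \<le> 1; i < n\<rbrakk> \<Longrightarrow> 0 \<le> g x i \<and> g x i \<le> 1"
    and unif: "\<And>e. e > 0 \<Longrightarrow> \<exists>d>0. \<forall>x y. (\<forall>j<n. 0 \<le> x j \<and> x j \<le> 1 \<and> 0 \<le> y j \<and> y j \<le> 1 \<and> \<bar>x j - y j\<bar> < d)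
        \<longrightarrow> (\<forall>i<n. \<bar>g x i - g y i\<bar> < e)"
    and e: "e > 0"
  shows "\<exists>x. (\<forall>j<n. 0 \<le> x j \<and> x j \<le> 1) \<and> (\<forall>i<n. \<bar>g x i - x i\<bar> < e)"
proof -
  obtain d0 where d0: "d0 > 0" and gd0: "\<And>x y i. \<lbrakk>\<And>j. j < n \<Longrightarrow> 0 \<le> x j \<and> x j \<le> 1 \<and> 0 \<le> y j \<and> y j \<le> 1 \<and> \<bar>x j - y j\<bar> < d0;
      i < n\<rbrakk> \<Longrightarrow> \<bar>g x i - g y i\<bar> < e/2"
    using unif[of "e/2"] e by (metis half_gt_zero)
  \<comment> \<open>A mesh below \<open>d0\<close> controls the oscillation of \<open>g\<close>, one
    below \<open>e/2\<close> that of the coordinates.\<close>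
  define d where "d = min d0 (e/2)"
  have "d > 0" using d0 e by (simp add: d_def)
  then obtain k where k: "inverse (real (Suc k)) < d"
    using reals_Archimedean by blast
  define p where "p = Suc k"
  have p: "p > 0" "1 / real p < d" using k by (auto simp: p_def inverse_eq_divide)
  define X where "X r i = real (r i) / real p" for r :: "nat \<Rightarrow> nat" and i
  \<comment> \<open>The test \<open>r i < p\<close> forces label 1 on the far face, as Kuhn's lemma
    demands; the meaning "\<open>g\<close> does not exceed the coordinate" stays correct there
    because \<open>g\<close> maps into the cube.\<close>
  define label where "label r i = (if r i < p \<and> X r i \<le> g (X r) i then 0 else 1 :: nat)" for r i
  have X01: "0 \<le> X r j \<and> X r j \<le> 1" if "r j \<le> p" for r j
    using that p by (simp add: X_def)
  have gX: "0 \<le> g (X r) i \<and> g (X r) i \<le> 1" if "\<forall>i<n. r i \<le> p" "i < n" for r i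
    using that X01 by (intro range) auto
  obtain q where q: "\<forall>i<n. q i < p"
    and qrs: "\<forall>i<n. \<exists>r s. (\<forall>j<n. q j \<le> r j \<and> r j \<le> q j + 1) \<and> (\<forall>j<n. q j \<le> s j \<and> s j \<le> q j + 1) \<and> label r i \<noteq> label s i"
  proof (rule kuhn_lemma[of p n label])
    show "\<forall>x. (\<forall>i<n. x i \<le> p) \<longrightarrow> (\<forall>i<n. x i = 0 \<longrightarrow> label x i = 0)"
      using gX p by (auto simp: label_def X_def)
  qed (use p in \<open>auto simp: label_def\<close>)
  have X0: "0 \<le> X q j \<and> X q j \<le> 1" if "j < n" for j using that q X01 by (meson less_imp_le)
  have near: "X q j \<le> X r j \<and> X r j < X q j + d \<and> 0 \<le> X r j \<and> X r j \<le> 1"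
    if "q j \<le> r j \<and> r j \<le> q j + 1" "j < n" for r j
  proof -
    have "real (r j) \<le> real (q j) + 1" using that by linarith
    then have "X r j \<le> X q j + 1 / real p"
      using p by (simp add: X_def field_simps)
    moreover have "r j \<le> p" using that q by (metis Suc_eq_plus1 Suc_leI order_trans)
    ultimately show ?thesis using that p X01[of r j] by (auto simp: X_def divide_right_mono)
  qed
  have lo: "X q i - e/2 < g (X q) i" if "\<forall>j<n. q j \<le> r j \<and> r j \<le> q j + 1" "label r i = 0" "i < n" for r i
  proof -
    have "\<bar>g (X q) i - g (X r) i\<bar> < e/2"
    proof (rule gd0)
      show "0 \<le> X q j \<and> X q j \<le> 1 \<and> 0 \<le> X r j \<and> X r j \<le> 1 \<and> \<bar>X q j - X r j\<bar> < d0" if j: "j < n" for j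
        using near[of j r] X0[of j] \<open>\<forall>j<n. q j \<le> r j \<and> r j \<le> q j + 1\<close> j by (auto simp: d_def)
    qed (use that in auto)
    moreover have "X r i \<le> g (X r) i" using that by (auto simp: label_def split: if_splits)
    moreover have "X q i \<le> X r i" using near that by blast
    ultimately show ?thesis by linarith
  qed
  have hi: "g (X q) i < X q i + e" if "\<forall>j<n. q j \<le> s j \<and> s j \<le> q j + 1" "label s i = 1" "i < n" for s i
  proof -
    have sp: "\<forall>j<n. s j \<le> p" using that q by (metis Suc_eq_plus1 Suc_leI order_trans)
    have "\<bar>g (X q) i - g (X s) i\<bar> < e/2"
    proof (rule gd0)
      show "0 \<le> X q j \<and> X q j \<le> 1 \<and> 0 \<le> X s j \<and> X s j \<le> 1 \<and> \<bar>X q j - X s j\<bar> < d0" if j: "j < n" for j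
        using near[of j s] X0[of j] \<open>\<forall>j<n. q j \<le> s j \<and> s j \<le> q j + 1\<close> j by (auto simp: d_def)
    qed (use that in auto)
    moreover have "g (X s) i \<le> X s i"
    proof (cases "s i = p")
      case True
      then have "X s i = 1" using p by (simp add: X_def)
      then show ?thesis using gX[OF sp \<open>i < n\<close>] by simp
    next
      case False
      then show ?thesis using that sp by (auto simp: label_def split: if_splits)
    qed
    moreover have "X s i < X q i + e/2" using near[of i s] that by (auto simp: d_def)
    ultimately show ?thesis by linarith
  qed
  have "\<bar>g (X q) i - X q i\<bar> < e" if i: "i < n" for i
  proof -
    obtain r s where rs: "\<forall>j<n. q j \<le> r j \<and> r j \<le> q j + 1" "\<forall>j<n. q j \<le> s j \<and> s j \<le> q j + 1" "label r i \<noteq> label s i"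
      using qrs i by blast
    have "label r i = 0 \<and> label s i = 1 \<or> label r i = 1 \<and> label s i = 0"
      using rs(3) by (auto simp: label_def split: if_splits)
    then show ?thesis using lo hi rs i e by (smt (verit, best) field_sum_of_halves)
  qed
  then show ?thesis using X0 by blast
qed

text \<open>Schauder projection: averaging the points of a finite \<open>e\<close>-net with a
  subordinate partition of unity moves each point by at most \<open>e\<close>, which reduces the
  problem to a simplex. The displacement \<open>dist (f x) x\<close> attains its minimum on
  \<open>S\<close>, so arbitrarily small displacements force a zero.\<close>

theorem schauder_compact_convex:
  fixes S :: "'a::real_normed_vector set"
  assumes S: "compact S" "convex S" "S \<noteq> {}"
    and f: "continuous_on S f" "f ` S \<subseteq> S"
  shows "\<exists>x\<in>S. f x = x"
proof -
  have approx: "\<exists>x\<in>S. dist (f x) x < 2 * e" if e: "e > 0" for e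
  proof -
    obtain k where k: "finite k" "k \<subseteq> S" "S \<subseteq> (\<Union>x\<in>k. ball x e)"
      using compactE_image[OF S(1), of S "\<lambda>x. ball x e"] e by (metis (no_types, lifting) UN_I centre_in_ball open_ball subsetI)
    obtain n and y :: "nat \<Rightarrow> 'a" where kn: "k = y ` {i. i < n}"
      using k(1) finite_imp_nat_seg_image_inj_on by metis
    then have y: "k = y ` {..<n}" by (simp add: lessThan_def)
    have n: "n > 0" using k(3) S(3) y by (cases n) auto
    have yS: "y i \<in> S" if "i < n" for i using that y k by auto
    \<comment> \<open>Changing every coefficient by less than \<open>c\<close> moves a combination
      of the net points by at most \<open>c * Y\<close>; the summand 1 keeps \<open>Y\<close>
      positive.\<close>
    define Y where "Y = 1 + (\<Sum>i<n. norm (y i))"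
    have Y: "Y > 0" unfolding Y_def by (simp add: add_pos_nonneg sum_nonneg)
    define w where "w x i = max 0 (e - dist x (y i))" for x i
    define l where "l x i = w x i / (\<Sum>j<n. w x j)" for x i
    have wnn: "w x i \<ge> 0" for x i by (simp add: w_def)
    have Wpos: "(\<Sum>j<n. w x j) > 0" if "x \<in> S" for x
    proof -
      have "\<exists>c\<in>k. x \<in> ball c e" using k(3) that by blast
      then obtain i where "i < n" "dist (y i) x < e" using y by auto
      then show ?thesis by (intro sum_pos2[of _ i]) (auto simp: w_def dist_commute)
    qed
    have lnn: "l x i \<ge> 0" for x i by (simp add: l_def wnn sum_nonneg)
    have lsum: "(\<Sum>i<n. l x i) = 1" if "x \<in> S" for x
      using Wpos[OF that] by (simp add: l_def flip: sum_divide_distrib)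
    have l1: "l x i \<le> 1" if "x \<in> S" "i < n" for x i
      using lsum[OF that(1)] member_le_sum[of i "{..<n}" "l x"] lnn that(2) by auto
    have wcont: "continuous_on S (\<lambda>x. w x i)" for i unfolding w_def by (intro continuous_intros)
    have lcont: "continuous_on S (\<lambda>x. l x i)" for i
      unfolding l_def using Wpos by (intro continuous_on_divide continuous_on_sum wcont) force
    \<comment> \<open>\<open>z \<mapsto> (\<rho> (z i, \<Sum>j<n. z j))\<^sub>i\<close> retracts the cube onto the standard simplex.\<close>
    define \<rho> where "\<rho> z = (fst z + max 0 (1 - snd z) / n) / max 1 (snd z)" for z :: "real \<times> real"
    define X where "X z = (\<Sum>i<n. \<rho> (z i, \<Sum>j<n. z j) *\<^sub>R y i)" for z :: "nat \<Rightarrow> real"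
    have \<rho>nn: "\<rho> (a, s) \<ge> 0" if "a \<ge> 0" for a s using that n by (auto simp: \<rho>_def)
    have \<rho>sum: "(\<Sum>i<n. \<rho> (z i, \<Sum>j<n. z j)) = 1" for z
    proof -
      have "(\<Sum>i<n. \<rho> (z i, \<Sum>j<n. z j)) = ((\<Sum>i<n. z i) + max 0 (1 - (\<Sum>j<n. z j))) / max 1 (\<Sum>j<n. z j)"
        using n by (simp add: \<rho>_def sum.distrib flip: sum_divide_distrib)
      also have "\<dots> = 1" by (auto simp: max_def)
      finally show ?thesis .
    qed
    have XS: "X z \<in> S" if "\<And>j. j < n \<Longrightarrow> 0 \<le> z j \<and> z j \<le> 1" for z
      unfolding X_def using that \<rho>nn \<rho>sum yS S(2) by (intro convex_sum) auto
    \<comment> \<open>\<open>\<rho>\<close> sees one coordinate and the sum only, so uniform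
      continuity on a planar rectangle controls all coordinates at once.\<close>
    have ucr: "uniformly_continuous_on ({0..1} \<times> {0..real n}) \<rho>"
      unfolding \<rho>_def by (intro compact_uniformly_continuous continuous_intros compact_Times) (use n in \<open>auto simp: max_def\<close>)
    have \<rho>unif: "\<exists>d>0. \<forall>x y. (\<forall>j<n. 0 \<le> x j \<and> x j \<le> 1 \<and> 0 \<le> y j \<and> y j \<le> 1 \<and> \<bar>x j - y j\<bar> < d)
        \<longrightarrow> (\<forall>i<n. \<bar>\<rho> (x i, \<Sum>j<n. x j) - \<rho> (y i, \<Sum>j<n. y j)\<bar> < c)" if c: "c > 0" for c
    proof -
      obtain d where d: "d > 0" and dd: "\<And>a b. \<lbrakk>a \<in> {0..1} \<times> {0..real n}; b \<in> {0..1} \<times> {0..real n}; dist b a < d\<rbrakk> \<Longrightarrow> dist (\<rho> b) (\<rho> a) < c"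
        using ucr c unfolding uniformly_continuous_on_def by metis
      define d' where "d' = (d / 2) / (1 + real n)"
      have "d' * (1 + real n) = d/2" using d'_def nonzero_eq_divide_eq[of "1 + real n" d' "d/2"] by linarith
      then have d': "d' + real n * d' = d/2" by (simp only: algebra_simps)
      have d'0: "d' > 0" unfolding d'_def using d by (intro divide_pos_pos) auto
      have "\<bar>\<rho> (x i, \<Sum>j<n. x j) - \<rho> (z i, \<Sum>j<n. z j)\<bar> < c"
        if xz: "\<forall>j<n. 0 \<le> x j \<and> x j \<le> 1 \<and> 0 \<le> z j \<and> z j \<le> 1 \<and> \<bar>x j - z j\<bar> < d'" and i: "i < n" for x z i
      proof -
        have s: "(\<Sum>j<n. x j) \<in> {0..real n}" "(\<Sum>j<n. z j) \<in> {0..real n}"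
          using xz sum_bounded_above[of "{..<n}" x 1] sum_bounded_above[of "{..<n}" z 1] by (auto intro!: sum_nonneg)
        have "\<bar>(\<Sum>j<n. x j) - (\<Sum>j<n. z j)\<bar> \<le> (\<Sum>j<n. \<bar>x j - z j\<bar>)"
          unfolding sum_subtractf[symmetric] by (rule sum_abs)
        also have "\<dots> \<le> real n * d'" using xz sum_bounded_above[of "{..<n}" "\<lambda>j. \<bar>x j - z j\<bar>" d'] by (simp add: less_imp_le)
        finally have "\<bar>(\<Sum>j<n. x j) - (\<Sum>j<n. z j)\<bar> \<le> real n * d'" .
        moreover have "\<bar>x i - z i\<bar> < d'" using xz i by blast
        ultimately have "dist (x i, \<Sum>j<n. x j) (z i, \<Sum>j<n. z j) < d"
          using d d' sqrt_sum_squares_le_sum_abs[of "x i - z i" "(\<Sum>j<n. x j) - (\<Sum>j<n. z j)"]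
          by (simp add: dist_Pair_Pair dist_real_def)
        then have "dist (\<rho> (x i, \<Sum>j<n. x j)) (\<rho> (z i, \<Sum>j<n. z j)) < c"
          using s xz i by (intro dd) auto
        then show ?thesis by (simp add: dist_real_def)
      qed
      then show ?thesis using d'0 by blast
    qed
    have diff: "norm ((\<Sum>i<n. a i *\<^sub>R y i) - (\<Sum>i<n. b i *\<^sub>R y i)) \<le> c * Y"
      if "\<forall>i<n. \<bar>a i - b i\<bar> < c" "c > 0" for a b :: "nat \<Rightarrow> real" and c
    proof -
      have "norm ((\<Sum>i<n. a i *\<^sub>R y i) - (\<Sum>i<n. b i *\<^sub>R y i)) = norm (\<Sum>i<n. (a i - b i) *\<^sub>R y i)"
        by (simp add: sum_subtractf algebra_simps)
      also have "\<dots> \<le> (\<Sum>i<n. norm ((a i - b i) *\<^sub>R y i))" by (rule norm_sum)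
      also have "\<dots> \<le> (\<Sum>i<n. c * norm (y i))"
        using that by (intro sum_mono) (simp add: mult_right_mono less_imp_le)
      also have "\<dots> \<le> c * Y" using that(2) by (simp add: Y_def sum_distrib_left algebra_simps)
      finally show ?thesis .
    qed
    define g where "g z i = l (f (X z)) i" for z i
    have fXS: "f (X z) \<in> S" if "\<And>j. j < n \<Longrightarrow> 0 \<le> z j \<and> z j \<le> 1" for z
      using f(2) XS that by (simp add: image_subset_iff)
    have gunif: "\<exists>d>0. \<forall>x y. (\<forall>j<n. 0 \<le> x j \<and> x j \<le> 1 \<and> 0 \<le> y j \<and> y j \<le> 1 \<and> \<bar>x j - y j\<bar> < d)
        \<longrightarrow> (\<forall>i<n. \<bar>g x i - g y i\<bar> < c)" if c: "c > 0" for c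
    proof -
      have "uniformly_continuous_on S (\<lambda>x. l (f x) i)" for i
        by (rule compact_uniformly_continuous[OF continuous_on_compose2[OF lcont f] S(1)])
      then have "\<forall>i. \<exists>d>0. \<forall>x\<in>S. \<forall>x'\<in>S. dist x' x < d \<longrightarrow> dist (l (f x') i) (l (f x) i) < c"
        using c unfolding uniformly_continuous_on_def by blast
      then obtain \<delta> where \<delta>: "\<And>i. \<delta> i > 0" "\<And>i x x'. \<lbrakk>x \<in> S; x' \<in> S; dist x' x < \<delta> i\<rbrakk> \<Longrightarrow> dist (l (f x') i) (l (f x) i) < c"
        by metis
      define d where "d = Min (\<delta> ` {..<n})"
      have d: "d > 0" "\<And>i. i < n \<Longrightarrow> d \<le> \<delta> i" using \<delta>(1) n by (auto simp: d_def Min_gr_iff lessThan_empty_iff)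
      define c' where "c' = d / (2 * Y)"
      have c': "c' > 0" "c' * Y < d" using d Y by (auto simp: c'_def)
      obtain d' where d': "d' > 0" and dd': "\<forall>x y. (\<forall>j<n. 0 \<le> x j \<and> x j \<le> 1 \<and> 0 \<le> y j \<and> y j \<le> 1 \<and> \<bar>x j - y j\<bar> < d')
        \<longrightarrow> (\<forall>i<n. \<bar>\<rho> (x i, \<Sum>j<n. x j) - \<rho> (y i, \<Sum>j<n. y j)\<bar> < c')"
        using \<rho>unif[OF c'(1)] by blast
      have "\<bar>g x i - g z i\<bar> < c"
        if xz: "\<forall>j<n. 0 \<le> x j \<and> x j \<le> 1 \<and> 0 \<le> z j \<and> z j \<le> 1 \<and> \<bar>x j - z j\<bar> < d'" and i: "i < n" for x z i
      proof -
        have "\<forall>i<n. \<bar>\<rho> (x i, \<Sum>j<n. x j) - \<rho> (z i, \<Sum>j<n. z j)\<bar> < c'"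
          by (rule dd'[THEN spec, THEN spec, THEN mp, OF xz])
        then have "norm (X x - X z) \<le> c' * Y"
          unfolding X_def by (intro diff c'(1))
        then have "dist (X x) (X z) < \<delta> i" using c' d(2)[OF i] by (simp add: dist_norm)
        moreover have "X x \<in> S" "X z \<in> S" using xz by (auto intro!: XS)
        ultimately have "dist (g x i) (g z i) < c" unfolding g_def by (intro \<delta>)
        then show ?thesis by (simp add: dist_real_def)
      qed
      then show ?thesis using d' by blast
    qed
    obtain d where d: "d > 0" and dd: "\<forall>x y. (\<forall>j<n. 0 \<le> x j \<and> x j \<le> 1 \<and> 0 \<le> y j \<and> y j \<le> 1 \<and> \<bar>x j - y j\<bar> < d)
        \<longrightarrow> (\<forall>i<n. \<bar>\<rho> (x i, \<Sum>j<n. x j) - \<rho> (y i, \<Sum>j<n. y j)\<bar> < e / (2 * Y))"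
      using \<rho>unif[of "e / (2 * Y)"] e Y by auto
    have grange: "0 \<le> g z i \<and> g z i \<le> 1" if "\<And>j. j < n \<Longrightarrow> 0 \<le> z j \<and> z j \<le> 1" "i < n" for z i
      unfolding g_def using lnn by (simp add: l1 fXS that)
    obtain z where z: "\<forall>j<n. 0 \<le> z j \<and> z j \<le> 1" and gz: "\<forall>i<n. \<bar>g z i - z i\<bar> < d"
      using brouwer_cube_approx[of n g d] grange gunif d by blast
    have gz01: "\<forall>i<n. 0 \<le> g z i \<and> g z i \<le> 1" using grange[of z] z by simp
    have gsum: "(\<Sum>j<n. g z j) = 1" unfolding g_def using z by (intro lsum fXS) simp
    \<comment> \<open>\<open>g z\<close> already lies on the simplex, which the retraction fixes
      pointwise.\<close>
    then have "\<rho> (g z i, \<Sum>j<n. g z j) = g z i" for i by (simp add: \<rho>_def)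
    moreover have "\<forall>i<n. \<bar>\<rho> (z i, \<Sum>j<n. z j) - \<rho> (g z i, \<Sum>j<n. g z j)\<bar> < e / (2 * Y)"
      using gz z gz01 by (intro dd[THEN spec, THEN spec, THEN mp]) (simp add: abs_minus_commute)
    ultimately have "\<forall>i<n. \<bar>\<rho> (z i, \<Sum>j<n. z j) - g z i\<bar> < e / (2 * Y)" by simp
    then have "norm (X z - (\<Sum>i<n. g z i *\<^sub>R y i)) \<le> e / (2 * Y) * Y"
      unfolding X_def using e Y by (intro diff) auto
    then have 1: "norm (X z - (\<Sum>i<n. g z i *\<^sub>R y i)) \<le> e / 2" using Y by simp
    have "norm ((\<Sum>i<n. g z i *\<^sub>R y i) - f (X z)) = norm (\<Sum>i<n. g z i *\<^sub>R (y i - f (X z)))"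
      using gsum by (simp add: scaleR_diff_right sum_subtractf flip: scaleR_left.sum)
    also have "\<dots> \<le> (\<Sum>i<n. norm (g z i *\<^sub>R (y i - f (X z))))" by (rule norm_sum)
    also have "\<dots> \<le> (\<Sum>i<n. g z i * e)"
    proof (intro sum_mono)
      fix i assume i: "i \<in> {..<n}"
      have "g z i = 0 \<or> norm (y i - f (X z)) \<le> e"
        by (auto simp: g_def l_def w_def dist_norm norm_minus_commute max_def)
      then have "g z i * norm (y i - f (X z)) \<le> g z i * e"
        using gz01 i by (auto intro: mult_left_mono)
      then show "norm (g z i *\<^sub>R (y i - f (X z))) \<le> g z i * e"
        using gz01 i by simp
    qed
    also have "\<dots> = e" using gsum by (simp flip: sum_distrib_right)
    finally have "dist (f (X z)) (X z) < 2 * e"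
      using 1 e norm_triangle_ineq[of "X z - (\<Sum>i<n. g z i *\<^sub>R y i)" "(\<Sum>i<n. g z i *\<^sub>R y i) - f (X z)"]
      by (simp add: dist_norm norm_minus_commute)
    then show ?thesis using XS z by blast
  qed
  have "continuous_on S (\<lambda>x. dist (f x) x)" using f(1) by (intro continuous_intros)
  then obtain x where x: "x \<in> S" "\<And>y. y \<in> S \<Longrightarrow> dist (f x) x \<le> dist (f y) y"
    using continuous_attains_inf[OF S(1,3)] by blast
  have "dist (f x) x \<le> 0"
  proof (rule ccontr)
    assume "\<not> dist (f x) x \<le> 0"
    then obtain y where "y \<in> S" "dist (f y) y < dist (f x) x" using approx[of "dist (f x) x / 2"] by auto
    then show False using x(2)[of y] by simp
  qed
  then show ?thesis using x by auto
qed

text \<open>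
  The parameter \<open>s\<close> is made an additional unknown, with \<open>s = \<tau>\<close> as its equation, where \<open>\<tau>\<close> is \<open>1\<close> at the
  fixed points in \<open>A\<close> and \<open>-1\<close> at those in \<open>B\<close>. This replaces a degree argument.
\<close>

theorem fixed_point_continuation:
  fixes D :: "'a::real_normed_vector set" and F :: "real \<times> 'a \<Rightarrow> 'a"
  assumes D: "compact D" "convex D" "D \<noteq> {}"
    and F: "continuous_on ({-1..1} \<times> D) F" "F ` ({-1..1} \<times> D) \<subseteq> D"
    and AB: "closed A" "closed B"
    and cover: "\<And>s x. \<lbrakk>s \<in> {-1..1}; x \<in> D; F (s, x) = x\<rbrakk> \<Longrightarrow> (s, x) \<in> A \<longleftrightarrow> (s, x) \<notin> B"
  shows "\<exists>x\<in>D. F (1, x) = x \<and> (1, x) \<in> A \<or> F (-1, x) = x \<and> (-1, x) \<in> B"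
proof -
  let ?C = "{-1..1::real} \<times> D"
  define S where "S = {z \<in> ?C. F z - snd z = 0}"
  have C: "compact ?C" "convex ?C" "?C \<noteq> {}"
    using D by (auto intro: compact_Times convex_Times)
  have S: "closed S" unfolding S_def
    by (intro continuous_closed_preimage_constant continuous_intros F compact_imp_closed C)
  have cl: "closed (A \<inter> S)" "closed (B \<inter> S)" using S AB by auto
  have dis: "(A \<inter> S) \<inter> (B \<inter> S) = {}" and cov: "S \<subseteq> A \<union> B" using cover by (auto simp: S_def)
  obtain \<tau> :: "real \<times> 'a \<Rightarrow> real" where \<tau>: "continuous_on UNIV \<tau>" "\<And>z. \<tau> z \<in> {-1..1}"
    "\<And>z. z \<in> A \<inter> S \<Longrightarrow> \<tau> z = 1" "\<And>z. z \<in> B \<inter> S \<Longrightarrow> \<tau> z = -1"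
  \<comment> \<open>\<open>infdist\<close> to the empty set is 0, so the quotient of distances below
    separates the two pieces only if both are nonempty.\<close>
  proof (cases "A \<inter> S = {} \<or> B \<inter> S = {}")
    case True
    then show ?thesis
      using that[of "\<lambda>_. -1"] that[of "\<lambda>_. 1"] by (auto intro: continuous_on_const)
  next
    case False
    define a b where "a z = infdist z (A \<inter> S)" and "b z = infdist z (B \<inter> S)" for z
    have ab0: "a z \<ge> 0" "b z \<ge> 0" for z by (simp_all add: a_def b_def infdist_nonneg)
    have a0: "a z = 0 \<longleftrightarrow> z \<in> A \<inter> S" and b0: "b z = 0 \<longleftrightarrow> z \<in> B \<inter> S" for z
      unfolding a_def b_def using False in_closed_iff_infdist_zero cl by metis+
    have pos: "a z + b z > 0" for z
      using ab0[of z] a0[of z] b0[of z] dis by (cases "a z = 0") auto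
    show ?thesis
    proof (rule that[of "\<lambda>z. (b z - a z) / (a z + b z)"])
      have "a z + b z \<noteq> 0" for z using pos[of z] by simp
      then show "continuous_on UNIV (\<lambda>z. (b z - a z) / (a z + b z))"
        unfolding a_def b_def by (intro continuous_intros) auto
    next
      fix z
      show "(b z - a z) / (a z + b z) \<in> {-1..1}"
        using ab0[of z] pos[of z] by (auto simp: field_simps)
      show "z \<in> A \<inter> S \<Longrightarrow> (b z - a z) / (a z + b z) = 1" using a0[of z] pos[of z] by simp
      show "z \<in> B \<inter> S \<Longrightarrow> (b z - a z) / (a z + b z) = -1" using b0[of z] pos[of z] by simp
    qed
  qed
  have "continuous_on ?C (\<lambda>z. (\<tau> z, F z))"
    by (intro continuous_intros F continuous_on_subset[OF \<tau>(1)]) auto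
  moreover have "(\<lambda>z. (\<tau> z, F z)) ` ?C \<subseteq> ?C" using \<tau>(2) F(2) by (auto simp del: atLeastAtMost_iff)
  ultimately obtain z where z: "z \<in> ?C" "(\<tau> z, F z) = z"
    using schauder_compact_convex[OF C] by blast
  then obtain s x where sx: "z = (s, x)" "s \<in> {-1..1}" "x \<in> D" "F (s, x) = x" "\<tau> (s, x) = s" by (cases z) auto
  have zS: "(s, x) \<in> S" using sx by (simp add: S_def)
  then consider "(s, x) \<in> A" | "(s, x) \<in> B" using cov by auto
  then show ?thesis
  proof cases
    case 1
    then have "s = 1" using \<tau>(3)[of "(s, x)"] zS sx by simp
    then show ?thesis using 1 sx by blast
  next
    case 2
    then have "s = -1" using \<tau>(4)[of "(s, x)"] zS sx by simp
    then show ?thesis using 2 sx by blast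
  qed
qed

section \<open>Compact sets of continuous functions\<close>

text \<open>A bounded Lipschitz ball of C[0,T], placed inside the bounded continuous functions on
  the line: the last condition extends each function by its end values, so the sup distance is
  decided on \<open>{0..T}\<close>.\<close>

definition lip_ball :: "real \<Rightarrow> real \<Rightarrow> real \<Rightarrow> (real \<Rightarrow>\<^sub>C real) set" where
  "lip_ball T B L = {u :: real \<Rightarrow>\<^sub>C real. (\<forall>x. \<bar>u x\<bar> \<le> B) \<and> (\<forall>x y. \<bar>u x - u y\<bar> \<le> L * \<bar>x - y\<bar>) \<and>
     (\<forall>x. u x = u (max 0 (min T x)))}"

lemma convex_lip_ball: "convex (lip_ball T B L)"
proof (rule convexI)
  fix u w :: "real \<Rightarrow>\<^sub>C real" and a b :: real
  assume u: "u \<in> lip_ball T B L" and w: "w \<in> lip_ball T B L" and ab: "0 \<le> a" "0 \<le> b" "a + b = 1"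
  let ?z = "a *\<^sub>R u + b *\<^sub>R w"
  have z: "?z x = a * u x + b * w x" for x by simp
  have "\<bar>?z x\<bar> \<le> B" for x
  proof -
    have "\<bar>a * u x + b * w x\<bar> \<le> a * \<bar>u x\<bar> + b * \<bar>w x\<bar>"
      using ab abs_triangle_ineq[of "a * u x" "b * w x"] by (simp add: abs_mult)
    also have "\<dots> \<le> a * B + b * B"
      using ab u w by (intro add_mono mult_left_mono) (auto simp: lip_ball_def)
    finally show ?thesis using ab by (simp add: z flip: distrib_right)
  qed
  moreover have "\<bar>?z x - ?z y\<bar> \<le> L * \<bar>x - y\<bar>" for x y
  proof -
    have "\<bar>?z x - ?z y\<bar> = \<bar>a * (u x - u y) + b * (w x - w y)\<bar>" by (simp add: algebra_simps)
    also have "\<dots> \<le> a * \<bar>u x - u y\<bar> + b * \<bar>w x - w y\<bar>"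
      using ab abs_triangle_ineq[of "a * (u x - u y)" "b * (w x - w y)"] by (simp add: abs_mult)
    also have "\<dots> \<le> a * (L * \<bar>x - y\<bar>) + b * (L * \<bar>x - y\<bar>)"
      using ab u w by (intro add_mono mult_left_mono) (auto simp: lip_ball_def)
    finally show ?thesis using ab by (simp flip: distrib_right)
  qed
  moreover have "?z x = ?z (max 0 (min T x))" for x
    using u w unfolding z lip_ball_def by simp
  ultimately show "?z \<in> lip_ball T B L" unfolding lip_ball_def by blast
qed

lemma compact_lip_ball:
  assumes T: "T > 0"
  shows "compact (lip_ball T B L)"
  unfolding compact_eq_seq_compact_metric seq_compact_def
proof (intro allI impI)
  fix f :: "nat \<Rightarrow> (real \<Rightarrow>\<^sub>C real)"
  assume "\<forall>n. f n \<in> lip_ball T B L"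
  then have fB: "\<bar>f n x\<bar> \<le> B" and fL: "\<bar>f n x - f n y\<bar> \<le> L * \<bar>x - y\<bar>"
    and fc: "f n x = f n (max 0 (min T x))" for n x y by (auto simp: lip_ball_def)
  define cl where "cl x = max 0 (min T x)" for x
  have clT: "cl x \<in> {0..T}" for x using T by (auto simp: cl_def)
  obtain g k where g: "continuous_on {0..T} g" and k: "strict_mono (k :: nat \<Rightarrow> nat)"
    and lim: "\<And>e. 0 < e \<Longrightarrow> \<exists>N. \<forall>n x. n \<ge> N \<and> x \<in> {0..T} \<longrightarrow> norm (f (k n) x - g x) < e"
  proof (rule Arzela_Ascoli[of "{0..T}" "\<lambda>n. apply_bcontfun (f n)" B])
    fix x e :: real
    assume e: "0 < e"
    have "\<bar>f n x - f n y\<bar> < e" if "norm (x - y) < e / (\<bar>L\<bar> + 1)" for n y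
    proof -
      have "\<bar>f n x - f n y\<bar> \<le> (\<bar>L\<bar> + 1) * \<bar>x - y\<bar>"
        using fL[of n x y] mult_right_mono[of L "\<bar>L\<bar> + 1" "\<bar>x - y\<bar>"] by linarith
      also have "\<dots> < e" using that by (simp add: field_simps)
      finally show ?thesis .
    qed
    then show "\<exists>d. 0 < d \<and> (\<forall>n y. y \<in> {0..T} \<and> norm (x - y) < d \<longrightarrow> norm (f n x - f n y) < e)"
      using e by (intro exI[of _ "e / (\<bar>L\<bar> + 1)"]) auto
  qed (use fB in auto)
  have "continuous_on UNIV (\<lambda>x. g (cl x))"
    by (rule continuous_on_compose2[OF g]) (use clT in \<open>auto simp: cl_def intro!: continuous_intros\<close>)
  moreover have pw: "(\<lambda>n. f (k n) x) \<longlonglongrightarrow> g (cl x)" for x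
    unfolding fc[of _ x] cl_def[symmetric]
    by (rule LIMSEQ_I) (use lim clT in blast)
  then have gB: "\<bar>g (cl x)\<bar> \<le> B" for x
    by (intro Lim_bounded[OF tendsto_rabs[OF pw], of 0]) (use fB in auto)
  ultimately have bc: "(\<lambda>x. g (cl x)) \<in> bcontfun" by (intro bcontfun_normI[of _ B]) auto
  define h where "h = Bcontfun (\<lambda>x. g (cl x))"
  have h: "h x = g (cl x)" for x unfolding h_def by (simp add: Bcontfun_inverse[OF bc])
  have "h \<in> lip_ball T B L"
    unfolding lip_ball_def
  proof (intro CollectI conjI allI)
    show "\<bar>h x\<bar> \<le> B" for x using gB h by simp
    show "\<bar>h x - h y\<bar> \<le> L * \<bar>x - y\<bar>" for x y
      unfolding h by (intro Lim_bounded[OF tendsto_rabs[OF tendsto_diff[OF pw pw]], of 0]) (use fL in auto)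
    show "h x = h (max 0 (min T x))" for x unfolding h cl_def by (rule arg_cong[of _ _ g]) auto
  qed
  moreover have "(f \<circ> k) \<longlonglongrightarrow> h"
  proof (rule metric_LIMSEQ_I)
    fix e :: real assume e: "e > 0"
    obtain N where N: "\<And>n x. n \<ge> N \<Longrightarrow> x \<in> {0..T} \<Longrightarrow> norm (f (k n) x - g x) < e / 2"
      using lim[of "e/2"] e by auto
    have "dist ((f \<circ> k) n) h < e" if "n \<ge> N" for n
    proof -
      have "dist (f (k n) x) (h x) \<le> e / 2" for x
      proof -
        have eq: "f (k n) x = f (k n) (cl x)" unfolding cl_def by (rule fc)
        show ?thesis using N[OF that clT[of x]] unfolding eq h dist_norm by (rule less_imp_le)
      qed
      then have "dist ((f \<circ> k) n) h \<le> e / 2" unfolding comp_def by (rule dist_bound)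
      then show ?thesis using e by simp
    qed
    then show "\<exists>no. \<forall>n\<ge>no. dist ((f \<circ> k) n) h < e" by blast
  qed
  ultimately show "\<exists>l\<in>lip_ball T B L. \<exists>r. strict_mono r \<and> (f \<circ> r) \<longlonglongrightarrow> l" using k by blast
qed

lemma continuous_on_apply_bcontfun2:
  fixes U :: "'a::topological_space \<Rightarrow> ('b::metric_space \<Rightarrow>\<^sub>C 'c::real_normed_vector)"
  assumes U: "continuous_on S U" and X: "continuous_on S X"
  shows "continuous_on S (\<lambda>z. apply_bcontfun (U z) (X z))"
  unfolding continuous_on_def
proof
  fix z0 assume z0: "z0 \<in> S"
  have "((\<lambda>z. dist (U z) (U z0)) \<longlongrightarrow> dist (U z0) (U z0)) (at z0 within S)"
    using U z0 by (intro tendsto_intros) (auto simp: continuous_on_def)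
  then have lim: "((\<lambda>z. dist (U z) (U z0)) \<longlongrightarrow> 0) (at z0 within S)" by simp
  have "((\<lambda>z. U z (X z) - U z0 (X z)) \<longlongrightarrow> 0) (at z0 within S)"
  proof (rule Lim_null_comparison[OF always_eventually lim], rule allI)
    show "norm (U z (X z) - U z0 (X z)) \<le> dist (U z) (U z0)" for z
      using dist_bounded[of "U z" "X z" "U z0"] by (simp add: dist_norm)
  qed
  moreover have "((\<lambda>z. U z0 (X z)) \<longlongrightarrow> U z0 (X z0)) (at z0 within S)"
  proof (rule isCont_tendsto_compose[of "X z0"])
    show "isCont (apply_bcontfun (U z0)) (X z0)"
      by (rule continuous_on_interior[OF continuous_on_apply_bcontfun[of UNIV]]) simp
    show "(X \<longlongrightarrow> X z0) (at z0 within S)" using X z0 by (auto simp: continuous_on_def)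
  qed
  ultimately have "((\<lambda>z. (U z (X z) - U z0 (X z)) + U z0 (X z)) \<longlongrightarrow> 0 + U z0 (X z0)) (at z0 within S)"
    by (rule tendsto_add)
  then show "((\<lambda>z. U z (X z)) \<longlongrightarrow> U z0 (X z0)) (at z0 within S)" by simp
qed

text \<open>Evaluations at rational points are continuous and separate continuous functions, so on
  the compact set \<open>K\<close> they form a homeomorphism onto the image. Pointwise dependence on
  \<open>z\<close>, which is easy to check for integrals with parameters, thus upgrades to
  dependence in the sup norm.\<close>

lemma continuous_on_into_compact_bcontfun:
  fixes F :: "'a::topological_space \<Rightarrow> (real \<Rightarrow>\<^sub>C real)"
  assumes K: "compact K" and FK: "\<And>z. z \<in> Z \<Longrightarrow> F z \<in> K"
    and pw: "\<And>x. continuous_on Z (\<lambda>z. F z x)"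
  shows "continuous_on Z F"
proof -
  define ev where "ev u r = apply_bcontfun u (of_rat r)" for u :: "real \<Rightarrow>\<^sub>C real" and r
  have inj: "u = w" if "ev u = ev w" for u w
  proof (rule bcontfun_eqI)
    fix x
    have "u x - w x = 0"
    proof (rule continuous_constant_on_closure[of "\<rat>" "\<lambda>x. u x - w x"])
      show "u x - w x = 0" if "x \<in> \<rat>" for x
        using that fun_cong[OF \<open>ev u = ev w\<close>] by (auto simp: ev_def elim!: Rats_cases)
    qed (auto intro!: continuous_intros simp: Rats_closure_real)
    then show "u x = w x" by simp
  qed
  define g where "g = inv_into K ev"
  have g: "g (ev u) = u" if "u \<in> K" for u
    unfolding g_def by (rule inv_into_f_f) (use inj that in \<open>auto simp: inj_on_def\<close>)
  have "continuous_on K ev"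
    unfolding ev_def
    by (intro continuous_on_coordinatewise_then_product continuous_on_apply_bcontfun2 continuous_intros)
  then have cg: "continuous_on (ev ` K) g" by (rule continuous_on_inv[OF _ K]) (use g in blast)
  have "continuous_on Z (\<lambda>z. ev (F z))"
    unfolding ev_def by (intro continuous_on_coordinatewise_then_product pw)
  then have "continuous_on Z (\<lambda>z. g (ev (F z)))"
    by (rule continuous_on_compose2[OF cg]) (use FK in auto)
  then show ?thesis using g FK by (simp cong: continuous_on_cong)
qed

text \<open>On a compact set a strict inequality between continuous functions has a positive margin,
  so its negation is closed in the sup norm.\<close>

lemma closed_ex_le_bcontfun:
  assumes I: "compact I" and b: "continuous_on I b"
  shows "closed {u :: real \<Rightarrow>\<^sub>C real. \<exists>x\<in>I. u x \<le> b x}"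
proof -
  have "open {u :: real \<Rightarrow>\<^sub>C real. \<forall>x\<in>I. b x < u x}"
    unfolding open_dist
  proof (intro ballI)
    fix u :: "real \<Rightarrow>\<^sub>C real" assume u: "u \<in> {u :: real \<Rightarrow>\<^sub>C real. \<forall>x\<in>I. b x < u x}"
    show "\<exists>e>0. \<forall>w. dist w u < e \<longrightarrow> w \<in> {u :: real \<Rightarrow>\<^sub>C real. \<forall>x\<in>I. b x < u x}"
    proof (cases "I = {}")
      case False
      have "continuous_on I (\<lambda>x. u x - b x)" by (intro continuous_intros b) auto
      then obtain x0 where x0: "x0 \<in> I" "\<And>x. x \<in> I \<Longrightarrow> u x0 - b x0 \<le> u x - b x"
        using continuous_attains_inf[OF I False] by blast
      have "b x < w x" if "dist w u < u x0 - b x0" "x \<in> I" for w x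
        using dist_bounded[of w x u] that x0(2)[of x] by (auto simp: dist_real_def)
      then show ?thesis using u x0(1) by (intro exI[of _ "u x0 - b x0"]) auto
    qed (auto intro: exI[of _ 1])
  qed
  moreover have "- {u :: real \<Rightarrow>\<^sub>C real. \<exists>x\<in>I. u x \<le> b x} = {u :: real \<Rightarrow>\<^sub>C real. \<forall>x\<in>I. b x < u x}" by (auto simp: not_le)
  ultimately show ?thesis by (simp add: closed_def)
qed

lemma closed_all_le_bcontfun: "closed {u :: real \<Rightarrow>\<^sub>C real. \<forall>x\<in>I. u x \<le> b x}"
proof -
  have "{u :: real \<Rightarrow>\<^sub>C real. \<forall>x\<in>I. u x \<le> b x} = (\<Inter>x\<in>I. {u :: real \<Rightarrow>\<^sub>C real. u x \<le> b x})" by auto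
  moreover have "closed {u :: real \<Rightarrow>\<^sub>C real. apply_bcontfun u x \<le> c}" for x c
    by (intro closed_Collect_le continuous_on_apply_bcontfun2 continuous_intros)
  ultimately show ?thesis by auto
qed

section \<open>Periodic solutions of flux equations\<close>

text \<open>For \<open>p < 2\<close> the factor with exponent \<open>p - 2\<close> blows up at 0;
  the form with the positive exponent \<open>p - 1\<close> shows continuity there.\<close>

lemma phi_eq_powr_diff: "p > 1 \<Longrightarrow> phi p s = max s 0 powr (p - 1) - max (- s) 0 powr (p - 1)"
proof -
  assume p: "p > 1"
  have *: "t powr (p - 2) * t = t powr (p - 1)" if "t > 0" for t :: real
    using that powr_add[of t "p - 2" 1] by simp
  show ?thesis
    using *[of s] *[of "- s"] p by (cases "s > 0"; cases "s = 0") (auto simp: phi_def)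
qed

lemma phi_nonneg_eq: "p > 1 \<Longrightarrow> s \<ge> 0 \<Longrightarrow> phi p s = s powr (p - 1)"
  by (simp add: phi_eq_powr_diff)

lemma phi_0 [simp]: "phi p 0 = 0" by (simp add: phi_def)

lemma phi_1 [simp]: "phi p 1 = 1" by (simp add: phi_def)

lemma phi_minus [simp]: "phi p (- s) = - phi p s" by (simp add: phi_def)

lemma phi_mult: "phi p (a * b) = phi p a * phi p b"
  by (simp add: phi_def abs_mult powr_mult)

lemma continuous_on_phi [continuous_intros]:
  assumes "p > 1" "continuous_on S u"
  shows "continuous_on S (\<lambda>x. phi p (u x))"
  unfolding phi_eq_powr_diff[OF assms(1)] using assms
  by (intro continuous_intros continuous_on_powr') auto

lemma strict_mono_phi: assumes p: "p > 1" shows "strict_mono (phi p)"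
proof (rule strict_monoI)
  fix x y :: real assume "x < y"
  consider "0 \<le> x" | "x < 0" "0 < y" | "y \<le> 0" by linarith
  then show "phi p x < phi p y"
  proof cases
    case 1
    then show ?thesis using \<open>x < y\<close> p by (simp add: phi_nonneg_eq powr_less_mono2)
  next
    case 2
    then show ?thesis using p by (simp add: phi_eq_powr_diff) (smt (verit) powr_gt_zero)
  next
    case 3
    then have "phi p (- y) < phi p (- x)" using \<open>x < y\<close> p by (simp only: phi_nonneg_eq) (simp add: phi_nonneg_eq powr_less_mono2)
    then show ?thesis by simp
  qed
qed

lemma phi_less_iff: "p > 1 \<Longrightarrow> phi p x < phi p y \<longleftrightarrow> x < y"
  by (simp add: strict_mono_less strict_mono_phi)

lemma phi_le_iff: "p > 1 \<Longrightarrow> phi p x \<le> phi p y \<longleftrightarrow> x \<le> y"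
  by (simp add: strict_mono_less_eq strict_mono_phi)

lemma phi_pos: "p > 1 \<Longrightarrow> 0 < x \<Longrightarrow> 0 < phi p x"
  using phi_less_iff[of p 0 x] by simp

lemma phi_nonneg: "p > 1 \<Longrightarrow> 0 \<le> x \<Longrightarrow> 0 \<le> phi p x"
  using phi_le_iff[of p 0 x] by simp

lemma phi_nonpos: "p > 1 \<Longrightarrow> x \<le> 0 \<Longrightarrow> phi p x \<le> 0"
  using phi_le_iff[of p x 0] by simp

lemma abs_phi: "\<bar>phi p x\<bar> = phi p \<bar>x\<bar>"
  by (simp add: phi_def abs_mult)

text \<open>The Hoelder conjugate exponent, for which \<open>phi (dual_exp p)\<close> inverts
  \<open>phi p\<close>.\<close>

definition dual_exp :: "real \<Rightarrow> real" where "dual_exp p = p / (p - 1)"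

lemma dual_exp_gt_1: "p > 1 \<Longrightarrow> dual_exp p > 1"
  by (simp add: dual_exp_def)

lemma phi_phi_dual: assumes p: "p > 1" shows "phi p (phi (dual_exp p) s) = s"
proof -
  have e: "(dual_exp p - 1) * (p - 1) = 1" using p by (simp add: dual_exp_def field_simps)
  have *: "phi p (phi (dual_exp p) t) = t" if "t \<ge> 0" for t
    using that p dual_exp_gt_1[OF p] e by (simp add: phi_nonneg_eq powr_powr)
  show ?thesis using *[of s] *[of "- s"] by (cases "s \<ge> 0") auto
qed

text \<open>The right-hand side \<open>g\<close> is an arbitrary function of \<open>x\<close>, so
  solutions, supersolutions and solutions of modified equations are all instances and can be
  compared with each other.\<close>

definition periodic_flux ::
  "real \<Rightarrow> real \<Rightarrow> (real \<Rightarrow> real) \<Rightarrow> (real \<Rightarrow> real) \<Rightarrow> (real \<Rightarrow> real) \<Rightarrow> bool" where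
  "periodic_flux T p u v g \<longleftrightarrow>
    (\<forall>x\<in>{0..T}. (u has_real_derivative v x) (at x within {0..T})) \<and> continuous_on {0..T} v \<and>
    (\<forall>x\<in>{0<..<T}. ((\<lambda>t. phi p (v t)) has_real_derivative g x) (at x)) \<and> u 0 = u T \<and> v 0 = v T"

lemma periodic_flux_cong:
  assumes "periodic_flux T p u v g" "\<And>x. x \<in> {0<..<T} \<Longrightarrow> g x = h x"
  shows "periodic_flux T p u v h"
  using assms unfolding periodic_flux_def by simp

lemma periodic_solution_iff_flux:
  "periodic_solution T p q m f lam u \<longleftrightarrow>
    (\<exists>v. periodic_flux T p u v (\<lambda>x. q x * phi p (u x) - lam * m x * f (u x)))"
proof -
  have *: "(g differentiable at x \<and> - deriv g x + a = b) \<longleftrightarrow> (g has_real_derivative (a - b)) (at x)"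
    for g :: "real \<Rightarrow> real" and x a b
  proof
    assume "g differentiable at x \<and> - deriv g x + a = b"
    then have "(g has_real_derivative deriv g x) (at x)" "deriv g x = a - b"
      by (auto simp: DERIV_deriv_iff_real_differentiable)
    then show "(g has_real_derivative (a - b)) (at x)" by simp
  next
    assume "(g has_real_derivative (a - b)) (at x)"
    then show "g differentiable at x \<and> - deriv g x + a = b"
      by (auto simp: DERIV_imp_deriv real_differentiable_def)
  qed
  show ?thesis unfolding periodic_solution_def periodic_flux_def * by simp
qed

lemma periodic_flux_continuous: "periodic_flux T p u v g \<Longrightarrow> continuous_on {0..T} u"
  unfolding periodic_flux_def by (meson DERIV_continuous_on)

section \<open>The periodic problem as a fixed point equation\<close>

text \<open>Subtracting the mean makes both end values equal to \<open>c\<close> for every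
  \<open>h\<close>; it is a primitive of \<open>h\<close> itself exactly when the mean
  vanishes.\<close>

definition primitive :: "real \<Rightarrow> real \<Rightarrow> (real \<Rightarrow> real) \<Rightarrow> real \<Rightarrow> real" where
  "primitive T c h x = c + (integral {0..x} h - x * (integral {0..T} h / T))"

lemma primitive_ends: "primitive T c h 0 = c" "T > 0 \<Longrightarrow> primitive T c h T = c"
  by (simp_all add: primitive_def)

lemma primitive_deriv:
  assumes "T > 0" "continuous_on {0..T} h" "x \<in> {0..T}"
  shows "(primitive T c h has_real_derivative h x - integral {0..T} h / T) (at x within {0..T})"
  unfolding primitive_def using assms
  by (auto intro!: derivative_eq_intros integral_has_real_derivative)

lemma mean_bound:
  fixes T :: real
  assumes "T > 0" "continuous_on {0..T} h" "\<And>x. x \<in> {0..T} \<Longrightarrow> \<bar>h x\<bar> \<le> M"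
  shows "\<bar>integral {0..T} h / T\<bar> \<le> M"
  using integral_bound[of 0 T h M] assms by (simp add: field_simps abs_le_iff)

lemma primitive_lipschitz:
  assumes T: "T > 0" and h: "continuous_on {0..T} h" and M: "\<And>x. x \<in> {0..T} \<Longrightarrow> \<bar>h x\<bar> \<le> M"
    and xy: "x \<in> {0..T}" "y \<in> {0..T}"
  shows "\<bar>primitive T c h x - primitive T c h y\<bar> \<le> 2 * M * \<bar>x - y\<bar>"
proof -
  have "norm (primitive T c h x - primitive T c h y) \<le> 2 * M * norm (x - y)"
  proof (rule field_differentiable_bound[of "{0..T}"])
    show "norm (h z - integral {0..T} h / T) \<le> 2 * M" if "z \<in> {0..T}" for z
      using M[OF that] mean_bound[OF T h M] unfolding real_norm_def by linarith
  qed (use primitive_deriv[OF T h] xy in auto)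
  then show ?thesis by simp
qed

definition clamped :: "real \<Rightarrow> (real \<Rightarrow> real) \<Rightarrow> (real \<Rightarrow>\<^sub>C real)" where
  "clamped T h = Bcontfun (\<lambda>x. h (max 0 (min T x)))"

lemma clamped_primitive:
  assumes T: "T > 0" and h: "continuous_on {0..T} h" and M: "\<And>x. x \<in> {0..T} \<Longrightarrow> \<bar>h x\<bar> \<le> M"
    and c: "\<bar>c\<bar> \<le> C"
  shows "apply_bcontfun (clamped T (primitive T c h)) x = primitive T c h (max 0 (min T x))"
    and "clamped T (primitive T c h) \<in> lip_ball T (C + 2 * M * T) (2 * M)"
proof -
  define cl where "cl x = max 0 (min T x)" for x
  have cl: "cl x \<in> {0..T}" "cl (cl x) = cl x" "\<bar>cl x - cl y\<bar> \<le> \<bar>x - y\<bar>" for x y using T by (auto simp: cl_def)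
  have M0: "M \<ge> 0" using M[of 0] T by force
  have L: "\<bar>primitive T c h (cl x) - primitive T c h (cl y)\<bar> \<le> 2 * M * \<bar>x - y\<bar>" for x y
    using primitive_lipschitz[OF T h M cl(1) cl(1), of c x y] cl(3)[of x y] M0
    by (smt (verit, best) mult_left_mono)
  have B: "\<bar>primitive T c h (cl x)\<bar> \<le> C + 2 * M * T" for x
  proof -
    have "\<bar>primitive T c h (cl x) - primitive T c h 0\<bar> \<le> 2 * M * \<bar>cl x - 0\<bar>"
      by (rule primitive_lipschitz[OF T h M]) (use cl T in auto)
    also have "\<dots> \<le> 2 * M * T" using cl(1)[of x] M0 by (intro mult_left_mono) auto
    finally show ?thesis using c T by (simp add: primitive_ends)
  qed
  have "continuous_on UNIV (\<lambda>x. primitive T c h (cl x))"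
  proof (rule continuous_on_compose2[of "{0..T}" "primitive T c h" UNIV cl])
    show "continuous_on {0..T} (primitive T c h)"
      using primitive_deriv[OF T h] by (rule DERIV_continuous_on)
  qed (use cl in \<open>auto simp: cl_def intro!: continuous_intros\<close>)
  then have "(\<lambda>x. primitive T c h (cl x)) \<in> bcontfun"
    using B by (intro bcontfun_normI[of _ "C + 2 * M * T"]) auto
  then have ap: "apply_bcontfun (clamped T (primitive T c h)) x = primitive T c h (cl x)" for x
    unfolding clamped_def cl_def[symmetric] by (simp add: Bcontfun_inverse)
  then show "apply_bcontfun (clamped T (primitive T c h)) x = primitive T c h (max 0 (min T x))"
    by (simp add: cl_def)
  show "clamped T (primitive T c h) \<in> lip_ball T (C + 2 * M * T) (2 * M)"
    unfolding lip_ball_def cl_def[symmetric] using B L by (simp add: ap cl(2))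
qed

text \<open>The equation becomes the first order system for \<open>u\<close> and the flux
  \<open>w\<close>: \<open>u'\<close> is the inverse of \<open>phi p\<close> at \<open>w\<close>,
  and \<open>w'\<close> is \<open>G s x u\<close>. A fixed point solves it only up to the mean
  \<open>k\<close> of the right-hand side; \<open>barrier\<close> is what excludes
  \<open>k \<noteq> 0\<close>. The implications from weak to strict inequality in \<open>b1\<close>
  and \<open>b2\<close> make "below \<open>b1\<close>" and "above \<open>b2\<close>" both open and
  closed along the solution set, and the conclusion at \<open>s = 0\<close> is that some solution is
  of neither kind.\<close>

theorem periodic_flux_continuation:
  fixes G :: "real \<Rightarrow> real \<Rightarrow> real \<Rightarrow> real"
  assumes T: "T > 0" and p: "p > 1" and R: "R > 0"
    and G: "continuous_on ({-1..1} \<times> {0..T} \<times> UNIV) (\<lambda>(s, x, y). G s x y)"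
    and B: "\<And>s x y. \<lbrakk>s \<in> {-1..1}; x \<in> {0..T}\<rbrakk> \<Longrightarrow> \<bar>G s x y\<bar> \<le> B"
    and barrier: "\<And>s u v k. \<lbrakk>s \<in> {-1..1}; periodic_flux T p u v (\<lambda>x. G s x (u x) - k)\<rbrakk>
        \<Longrightarrow> (k < 0 \<longrightarrow> u 0 < R) \<and> (k > 0 \<longrightarrow> - R < u 0)"
    and b: "continuous_on {0..T} b1" "continuous_on {0..T} b2" "\<exists>x\<in>{0..T}. b1 x < b2 x"
    and b1: "\<And>s u v. \<lbrakk>s \<in> {-1..0}; periodic_flux T p u v (\<lambda>x. G s x (u x)); \<forall>x\<in>{0..T}. u x \<le> b1 x\<rbrakk>
        \<Longrightarrow> \<forall>x\<in>{0..T}. u x < b1 x"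
    and b2: "\<And>s u v. \<lbrakk>s \<in> {0..1}; periodic_flux T p u v (\<lambda>x. G s x (u x)); \<forall>x\<in>{0..T}. b2 x \<le> u x\<rbrakk>
        \<Longrightarrow> \<forall>x\<in>{0..T}. b2 x < u x"
    and minus1: "\<And>u v. periodic_flux T p u v (\<lambda>x. G (-1) x (u x)) \<Longrightarrow> \<forall>x\<in>{0..T}. u x \<le> b1 x"
    and plus1: "\<And>u v. periodic_flux T p u v (\<lambda>x. G 1 x (u x)) \<Longrightarrow> \<forall>x\<in>{0..T}. b2 x \<le> u x"
  shows "\<exists>u v. periodic_flux T p u v (\<lambda>x. G 1 x (u x))"
    and "\<exists>u v. periodic_flux T p u v (\<lambda>x. G 0 x (u x)) \<and>
           (\<exists>x\<in>{0..T}. b1 x < u x) \<and> (\<exists>x\<in>{0..T}. u x < b2 x)"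
proof -
  let ?\<psi> = "phi (dual_exp p)"
  have p': "dual_exp p > 1" using p by (rule dual_exp_gt_1)
  define R2 where "R2 = 2 * B * T + 1"
  have B0: "B \<ge> 0" using B[of 0 0 0] T by force
  have R2: "R2 > 0" using B0 T by (simp add: R2_def add_nonneg_pos)
  \<comment> \<open>Elements of \<open>D2\<close> are bounded by \<open>R2 + 2 * B * T\<close>, so
    \<open>V\<close> bounds \<open>u'\<close>; together with the subtracted mean this gives the
    Lipschitz constant \<open>2 * V\<close> of \<open>D1\<close>.\<close>
  define V where "V = ?\<psi> (R2 + 2 * B * T)"
  define D1 where "D1 = lip_ball T (R + 2 * V * T) (2 * V)"
  define D2 where "D2 = lip_ball T (R2 + 2 * B * T) (2 * B)"
  define GG where "GG z t = G (fst z) t (apply_bcontfun (fst (snd z)) t)"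
    for z :: "real \<times> (real \<Rightarrow>\<^sub>C real) \<times> (real \<Rightarrow>\<^sub>C real)" and t
  define VV where "VV z t = ?\<psi> (apply_bcontfun (snd (snd z)) t)"
    for z :: "real \<times> (real \<Rightarrow>\<^sub>C real) \<times> (real \<Rightarrow>\<^sub>C real)" and t
  \<comment> \<open>The clamps make the means of both integrands vanish at a fixed point: a nonzero mean would push
    the initial value to the end of the clamping interval on the side excluded by the sign condition.\<close>
  define c1 where "c1 z = max (- R) (min R (apply_bcontfun (fst (snd z)) 0 - integral {0..T} (GG z) / T))" for z
  define c2 where "c2 z = max (- R2) (min R2 (apply_bcontfun (snd (snd z)) 0 - integral {0..T} (VV z) / T))" for z
  define F where "F z = (clamped T (primitive T (c1 z) (VV z)), clamped T (primitive T (c2 z) (GG z)))" for z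
  let ?D = "D1 \<times> D2" and ?Z = "{-1..1::real} \<times> D1 \<times> D2"
  have GGc2: "continuous_on (?Z \<times> {0..T}) (\<lambda>(z, t). GG z t)"
    unfolding GG_def case_prod_unfold
    by (rule continuous_on_compose2[OF G[unfolded case_prod_unfold], of _ "\<lambda>w. (fst (fst w), snd w, apply_bcontfun (fst (snd (fst w))) (snd w))", simplified])
       (auto intro!: continuous_intros continuous_on_apply_bcontfun2)
  have VVc2: "continuous_on (?Z \<times> {0..T}) (\<lambda>(z, t). VV z t)"
    unfolding VV_def case_prod_unfold
    by (intro continuous_on_phi p' continuous_on_apply_bcontfun2 continuous_intros)
  have GGc: "continuous_on {0..T} (GG z)" if "z \<in> ?Z" for z
  proof -
    have "continuous_on {0..T} (\<lambda>t. (\<lambda>(z, t). GG z t) (z, t))"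
      by (rule continuous_on_compose2[OF GGc2]) (use that in \<open>auto intro!: continuous_on_Pair continuous_on_const continuous_on_id\<close>)
    then show ?thesis by simp
  qed
  have VVc: "continuous_on {0..T} (VV z)" for z
    unfolding VV_def by (intro continuous_on_phi p' continuous_on_apply_bcontfun2 continuous_intros)
  have GGB: "\<bar>GG z t\<bar> \<le> B" if "z \<in> ?Z" "t \<in> {0..T}" for z t
    unfolding GG_def using that by (intro B) auto
  have VVB: "\<bar>VV z t\<bar> \<le> V" if "z \<in> ?Z" for z t
    unfolding VV_def abs_phi V_def phi_le_iff[OF p'] using that by (auto simp: D2_def lip_ball_def)
  have c1R: "\<bar>c1 z\<bar> \<le> R" and c2R: "\<bar>c2 z\<bar> \<le> R2" for z using R R2 by (auto simp: c1_def c2_def)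
  have U: "apply_bcontfun (clamped T (primitive T (c1 z) (VV z))) x = primitive T (c1 z) (VV z) (max 0 (min T x))"
      "clamped T (primitive T (c1 z) (VV z)) \<in> D1"
    and W: "apply_bcontfun (clamped T (primitive T (c2 z) (GG z))) x = primitive T (c2 z) (GG z) (max 0 (min T x))"
      "clamped T (primitive T (c2 z) (GG z)) \<in> D2" if "z \<in> ?Z" for z x
    unfolding D1_def D2_def
    by (intro clamped_primitive[OF T VVc VVB[OF that] c1R] clamped_primitive[OF T GGc[OF that] GGB[OF that] c2R]; assumption)+
  have Fim: "F ` ?Z \<subseteq> ?D" using U(2) W(2) by (auto simp: F_def)
  have int_cont: "continuous_on ?Z (\<lambda>z. integral {0..x} (H z))"
    if H: "continuous_on (?Z \<times> {0..T}) (\<lambda>(z, t). H z t)" and x: "x \<in> {0..T}" for H :: "_ \<Rightarrow> real \<Rightarrow> real" and x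
  proof -
    have "continuous_on (?Z \<times> cbox 0 x) (\<lambda>(z, t). H z t)"
      by (rule continuous_on_subset[OF H]) (use x in auto)
    then show ?thesis using integral_continuous_on_param[of ?Z 0 x H] by simp
  qed
  have prim_cont: "continuous_on ?Z (\<lambda>z. primitive T (c z) (H z) (max 0 (min T x)))"
    if "continuous_on (?Z \<times> {0..T}) (\<lambda>(z, t). H z t)" "continuous_on ?Z c" for H c x
    unfolding primitive_def using that T by (intro continuous_intros int_cont) auto
  have c1c: "continuous_on ?Z c1" and c2c: "continuous_on ?Z c2"
    unfolding c1_def c2_def using T
    by (intro continuous_intros int_cont GGc2 VVc2 continuous_on_apply_bcontfun2; simp)+
  have Fcont: "continuous_on ?Z F"
    unfolding F_def
  proof (rule continuous_on_Pair)
    show "continuous_on ?Z (\<lambda>z. clamped T (primitive T (c1 z) (VV z)))"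
    proof (rule continuous_on_into_compact_bcontfun[of D1])
      show "compact D1" unfolding D1_def by (rule compact_lip_ball[OF T])
      show "clamped T (primitive T (c1 z) (VV z)) \<in> D1" if "z \<in> ?Z" for z
        using U(2) that .
      show "continuous_on ?Z (\<lambda>z. clamped T (primitive T (c1 z) (VV z)) x)" for x
        using prim_cont[OF VVc2 c1c, of x] by (rule continuous_on_eq) (use U(1) in auto)
    qed
    show "continuous_on ?Z (\<lambda>z. clamped T (primitive T (c2 z) (GG z)))"
    proof (rule continuous_on_into_compact_bcontfun[of D2])
      show "compact D2" unfolding D2_def by (rule compact_lip_ball[OF T])
      show "clamped T (primitive T (c2 z) (GG z)) \<in> D2" if "z \<in> ?Z" for z
        using W(2) that .
      show "continuous_on ?Z (\<lambda>z. clamped T (primitive T (c2 z) (GG z)) x)" for x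
        using prim_cont[OF GGc2 c2c, of x] by (rule continuous_on_eq) (use W(1) in auto)
    qed
  qed
  have comp: "compact ?D" "convex ?D"
    unfolding D1_def D2_def using T by (auto intro!: compact_Times convex_Times compact_lip_ball convex_lip_ball)
  have ne: "?D \<noteq> {}"
  proof -
    have 0: "0 \<in> lip_ball T C L" if "C \<ge> 0" "L \<ge> 0" for C L using that by (auto simp: lip_ball_def)
    have "V \<ge> 0" unfolding V_def using B0 T R2 by (intro phi_nonneg p') auto
    then have "0 \<in> D1" "0 \<in> D2" unfolding D1_def D2_def using R R2 B0 T by (auto intro!: 0)
    then show ?thesis by blast
  qed
  have fixed: "periodic_flux T p (apply_bcontfun u) (\<lambda>x. ?\<psi> (w x)) (\<lambda>x. G s x (u x))"
    if s: "s \<in> {-1..1}" and uw: "(u, w) \<in> ?D" and fp: "F (s, u, w) = (u, w)" for s u w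
  proof -
    define z where "z = (s, u, w)"
    have z: "z \<in> ?Z" using s uw by (simp add: z_def)
    have GGz: "GG z t = G s t (u t)" and VVz: "VV z t = ?\<psi> (w t)" for t by (simp_all add: GG_def VV_def z_def)
    have ux: "u x = primitive T (c1 z) (VV z) x" and wx: "w x = primitive T (c2 z) (GG z) x" if "x \<in> {0..T}" for x
      using fp U(1)[OF z, of x] W(1)[OF z, of x] that by (auto simp: F_def z_def min_def max_def)
    define k where "k = integral {0..T} (GG z) / T"
    define l where "l = integral {0..T} (VV z) / T"
    have u0: "u 0 = c1 z" "u T = c1 z" and w0: "w 0 = c2 z" "w T = c2 z"
      using T by (simp_all add: ux wx primitive_ends)
    have c1z: "c1 z = max (- R) (min R (u 0 - k))" and c2z: "c2 z = max (- R2) (min R2 (w 0 - l))"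
      by (simp_all add: c1_def c2_def k_def l_def z_def)
    have wnear: "\<bar>w x - w 0\<bar> \<le> 2 * B * T" if x: "x \<in> {0..T}" for x
    proof -
      have "\<bar>w x - w 0\<bar> \<le> 2 * B * \<bar>x - 0\<bar>"
        using primitive_lipschitz[OF T GGc[OF z] GGB[OF z] x, of 0] x T by (simp add: wx)
      also have "\<dots> \<le> 2 * B * T" using x B0 by (intro mult_left_mono) auto
      finally show ?thesis .
    qed
    \<comment> \<open>By \<open>wnear\<close> and the choice of \<open>R2\<close>, an extreme value of \<open>w 0\<close> fixes the sign of \<open>w\<close> everywhere.\<close>
    have l0: "l = 0"
    proof (rule ccontr)
      assume "l \<noteq> 0"
      then consider "l > 0" "w 0 = - R2" | "l < 0" "w 0 = R2" using w0(1) c2z R2 by linarith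
      then show False
      proof cases
        case 1
        have "integral {0..T} (VV z) \<le> integral {0..T} (\<lambda>_. 0)"
        proof (rule integral_le)
          show "VV z x \<le> 0" if "x \<in> {0..T}" for x
            unfolding VVz using wnear[OF that] 1 by (intro phi_nonpos p') (auto simp: R2_def)
        qed (auto intro: integrable_continuous_real VVc)
        then show False using 1 T by (simp add: l_def zero_less_divide_iff)
      next
        case 2
        have "integral {0..T} (\<lambda>_. 0) \<le> integral {0..T} (VV z)"
        proof (rule integral_le)
          show "0 \<le> VV z x" if "x \<in> {0..T}" for x
            unfolding VVz using wnear[OF that] 2 by (intro phi_nonneg p') (auto simp: R2_def)
        qed (auto intro: integrable_continuous_real VVc)
        then show False using 2 T by (simp add: l_def divide_less_0_iff)
      qed
    qed
    have flux: "periodic_flux T p u (\<lambda>x. ?\<psi> (w x)) (\<lambda>x. G s x (u x) - k)"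
      unfolding periodic_flux_def
    proof (intro conjI ballI)
      fix x assume x: "x \<in> {0..T}"
      have "(primitive T (c1 z) (VV z) has_real_derivative ?\<psi> (w x)) (at x within {0..T})"
        using primitive_deriv[OF T VVc x, of "c1 z" z] l0 T by (simp add: l_def VVz)
      then show "(u has_real_derivative ?\<psi> (w x)) (at x within {0..T})"
        by (rule has_field_derivative_transform_within[of _ _ _ _ 1]) (use x ux in auto)
    next
      fix x assume x: "x \<in> {0<..<T}"
      then have "(primitive T (c2 z) (GG z) has_real_derivative GG z x - k) (at x within {0..T})"
        using primitive_deriv[OF T GGc[OF z], of x "c2 z"] by (simp add: k_def)
      then have "(w has_real_derivative GG z x - k) (at x within {0..T})"
        by (rule has_field_derivative_transform_within[of _ _ _ _ 1]) (use x wx in auto)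
      then have "(w has_real_derivative GG z x - k) (at x)"
        using x by (simp add: at_within_Icc_at)
      then show "((\<lambda>t. phi p (?\<psi> (w t))) has_real_derivative G s x (u x) - k) (at x)"
        by (simp add: phi_phi_dual p GGz)
    qed (use u0 w0 p' in \<open>auto intro!: continuous_on_phi\<close>)
    have "k = 0"
      using barrier[OF s flux] u0(1) c1z R by linarith
    then show ?thesis using flux by simp
  qed
  let ?A0 = "{u :: real \<Rightarrow>\<^sub>C real. \<forall>x\<in>{0..T}. u x \<le> b1 x}"
  let ?A1 = "{u :: real \<Rightarrow>\<^sub>C real. \<exists>x\<in>{0..T}. u x \<le> b2 x}"
  \<comment> \<open>Written with \<open>- u\<close>, these are preimages under negation of sets
    covered by the two closedness lemmas.\<close>
  let ?B0 = "{u :: real \<Rightarrow>\<^sub>C real. \<exists>x\<in>{0..T}. - u x \<le> - b1 x}"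
  let ?B1 = "{u :: real \<Rightarrow>\<^sub>C real. \<forall>x\<in>{0..T}. - u x \<le> - b2 x}"
  have um: "continuous_on UNIV (uminus :: (real \<Rightarrow>\<^sub>C real) \<Rightarrow> _)" by (intro continuous_intros)
  have "continuous_on {0..T} (\<lambda>x. - b1 x)" using b by (intro continuous_intros)
  then have clB: "closed ?B0" "closed ?B1"
    using closed_vimage[OF closed_ex_le_bcontfun[of "{0..T}" "\<lambda>x. - b1 x"] um]
      closed_vimage[OF closed_all_le_bcontfun[of "{0..T}" "\<lambda>x. - b2 x"] um]
    by (simp_all add: vimage_def)
  have clA: "closed ?A0" "closed ?A1"
    using b by (auto intro: closed_ex_le_bcontfun closed_all_le_bcontfun)
  \<comment> \<open>\<open>A\<close> means "below \<open>b1\<close>" for \<open>s \<le> 0\<close>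
    and "not above \<open>b2\<close>" for \<open>s \<ge> 0\<close>; \<open>B'\<close> is the
    opposite, with weak inequalities so that both are closed. At \<open>s = 0\<close> the two
    descriptions agree on solutions only if each solution is below \<open>b1\<close> or above
    \<open>b2\<close>, which is the assumption to be refuted.\<close>
  define A where "A = {..0::real} \<times> ?A0 \<times> (UNIV :: (real \<Rightarrow>\<^sub>C real) set) \<union> {0..} \<times> ?A1 \<times> UNIV"
  define B' where "B' = {..0::real} \<times> ?B0 \<times> (UNIV :: (real \<Rightarrow>\<^sub>C real) set) \<union> {0..} \<times> ?B1 \<times> UNIV"
  have AB: "closed A" "closed B'"
    unfolding A_def B'_def by (intro closed_Un closed_Times clA clB closed_UNIV closed_atMost closed_atLeast)+
  \<comment> \<open>With \<open>A\<close> everything and \<open>B\<close> empty, the continuation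
    theorem is plain existence at \<open>s = 1\<close>.\<close>
  have "\<exists>x\<in>?D. F (1, x) = x"
    using fixed_point_continuation[OF comp ne Fcont Fim closed_UNIV closed_empty] by auto
  then obtain u w where "(u, w) \<in> ?D" "F (1, u, w) = (u, w)" by (metis surj_pair)
  then show "\<exists>u v. periodic_flux T p u v (\<lambda>x. G 1 x (u x))"
    using fixed[of 1 u w] by auto
  show "\<exists>u v. periodic_flux T p u v (\<lambda>x. G 0 x (u x)) \<and>
           (\<exists>x\<in>{0..T}. b1 x < u x) \<and> (\<exists>x\<in>{0..T}. u x < b2 x)"
  proof (rule ccontr)
    assume none: "\<not> ?thesis"
    have "\<exists>x\<in>?D. F (1, x) = x \<and> (1, x) \<in> A \<or> F (-1, x) = x \<and> (-1, x) \<in> B'"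
    proof (rule fixed_point_continuation[OF comp ne Fcont Fim AB])
      fix s and x :: "(real \<Rightarrow>\<^sub>C real) \<times> (real \<Rightarrow>\<^sub>C real)"
      assume s: "s \<in> {-1..1}" and x: "x \<in> ?D" "F (s, x) = x"
      obtain u w where uw: "x = (u, w)" by (cases x)
      note fl = fixed[OF s x[unfolded uw]]
      have mA: "(s, u, w) \<in> A \<longleftrightarrow> s \<le> 0 \<and> (\<forall>x\<in>{0..T}. u x \<le> b1 x) \<or> s \<ge> 0 \<and> (\<exists>x\<in>{0..T}. u x \<le> b2 x)"
        and mB: "(s, u, w) \<in> B' \<longleftrightarrow> s \<le> 0 \<and> (\<exists>x\<in>{0..T}. b1 x \<le> u x) \<or> s \<ge> 0 \<and> (\<forall>x\<in>{0..T}. b2 x \<le> u x)"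
        by (auto simp: A_def B'_def)
      have 1: "(\<forall>x\<in>{0..T}. u x \<le> b1 x) \<longleftrightarrow> \<not> (\<exists>x\<in>{0..T}. b1 x \<le> u x)" if "s \<le> 0"
      proof -
        have "(\<forall>x\<in>{0..T}. u x \<le> b1 x) \<longrightarrow> (\<forall>x\<in>{0..T}. u x < b1 x)" using b1[OF _ fl] s that by auto
        then show ?thesis by (meson less_imp_le not_le)
      qed
      have 2: "(\<forall>x\<in>{0..T}. b2 x \<le> u x) \<longleftrightarrow> \<not> (\<exists>x\<in>{0..T}. u x \<le> b2 x)" if "s \<ge> 0"
      proof -
        have "(\<forall>x\<in>{0..T}. b2 x \<le> u x) \<longrightarrow> (\<forall>x\<in>{0..T}. b2 x < u x)" using b2[OF _ fl] s that by auto
        then show ?thesis by (meson less_imp_le not_le)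
      qed
      have 3: "(\<forall>x\<in>{0..T}. u x \<le> b1 x) \<longleftrightarrow> \<not> (\<forall>x\<in>{0..T}. b2 x \<le> u x)" if "s = 0"
      proof -
        have "(\<forall>x\<in>{0..T}. u x \<le> b1 x) \<or> (\<forall>x\<in>{0..T}. b2 x \<le> u x)"
          using none fl unfolding that by (meson not_le)
        moreover have "\<not> ((\<forall>x\<in>{0..T}. u x \<le> b1 x) \<and> (\<forall>x\<in>{0..T}. b2 x \<le> u x))"
          using b(3) by (meson not_le order_trans)
        ultimately show ?thesis by blast
      qed
      show "(s, x) \<in> A \<longleftrightarrow> (s, x) \<notin> B'"
        unfolding uw mA mB using 1 2 3 by (cases s "0::real" rule: linorder_cases) auto
    qed
    then obtain u w where uw: "(u, w) \<in> ?D" and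
      "F (1, u, w) = (u, w) \<and> (1, u, w) \<in> A \<or> F (-1, u, w) = (u, w) \<and> (-1, u, w) \<in> B'"
      by (metis surj_pair)
    then consider "F (1, u, w) = (u, w)" "(1, u, w) \<in> A" | "F (-1, u, w) = (u, w)" "(-1, u, w) \<in> B'" by blast
    then show False
    proof cases
      case 1
      have fl: "periodic_flux T p u (\<lambda>x. ?\<psi> (w x)) (\<lambda>x. G 1 x (u x))" using fixed[of 1] uw 1 by simp
      show False using b2[OF _ fl plus1[OF fl]] 1(2) by (auto simp: A_def)
    next
      case 2
      have fl: "periodic_flux T p u (\<lambda>x. ?\<psi> (w x)) (\<lambda>x. G (-1) x (u x))" using fixed[of "-1"] uw 2 by simp
      show False using b1[OF _ fl minus1[OF fl]] 2(2) by (auto simp: B'_def)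
    qed
  qed
qed

section \<open>Comparison and barriers\<close>

lemma deriv_max_right:
  fixes f :: "real \<Rightarrow> real"
  assumes f: "(f has_real_derivative l) (at x within {a..b})" and x: "a \<le> x" "x < b"
    and max: "\<And>y. y \<in> {a..b} \<Longrightarrow> f y \<le> f x"
  shows "l \<le> 0"
proof (rule ccontr)
  assume "\<not> l \<le> 0"
  then obtain d where d: "d > 0" "\<And>h. \<lbrakk>h > 0; x + h \<in> {a..b}; h < d\<rbrakk> \<Longrightarrow> f x < f (x + h)"
    using has_real_derivative_pos_inc_right[OF f] by auto
  define h where "h = min (d/2) (b - x)"
  have "h > 0" "x + h \<in> {a..b}" "h < d" using d x by (auto simp: h_def)
  then show False using d(2) max by (meson not_le)
qed

lemma deriv_max_left:
  fixes f :: "real \<Rightarrow> real"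
  assumes f: "(f has_real_derivative l) (at x within {a..b})" and x: "a < x" "x \<le> b"
    and max: "\<And>y. y \<in> {a..b} \<Longrightarrow> f y \<le> f x"
  shows "l \<ge> 0"
proof (rule ccontr)
  assume "\<not> l \<ge> 0"
  then obtain d where d: "d > 0" "\<And>h. \<lbrakk>h > 0; x - h \<in> {a..b}; h < d\<rbrakk> \<Longrightarrow> f x < f (x - h)"
    using has_real_derivative_neg_dec_left[OF f] by auto
  define h where "h = min (d/2) (x - a)"
  have "h > 0" "x - h \<in> {a..b}" "h < d" using d x by (auto simp: h_def)
  then show False using d(2) max by (meson not_le)
qed

text \<open>A maximum at one end point is attained at both, where the one-sided slopes have opposite
  weak signs; by periodicity they are equal, hence zero.\<close>

lemma periodic_max_deriv:
  fixes u :: "real \<Rightarrow> real"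
  assumes T: "T > 0" and u: "\<And>x. x \<in> {0..T} \<Longrightarrow> (u has_real_derivative v x) (at x within {0..T})"
    and per: "u 0 = u T" "v 0 = v T"
    and x: "x \<in> {0..T}" and max: "\<And>y. y \<in> {0..T} \<Longrightarrow> u y \<le> u x"
  shows "v x = 0"
proof (cases "x = 0 \<or> x = T")
  case True
  then have m: "\<And>y. y \<in> {0..T} \<Longrightarrow> u y \<le> u 0" "\<And>y. y \<in> {0..T} \<Longrightarrow> u y \<le> u T" using max per by auto
  have "v 0 \<le> 0" using u[of 0] T m by (intro deriv_max_right[of u "v 0" 0 0 T]) auto
  moreover have "v T \<ge> 0" using u[of T] T m by (intro deriv_max_left[of u "v T" T 0 T]) auto
  ultimately show ?thesis using per True by auto
next
  case False
  then have "0 < x" "x < T" using x by auto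
  then show ?thesis
    using deriv_max_right[OF u[OF x]] deriv_max_left[OF u[OF x]] max by (meson antisym less_imp_le)
qed

text \<open>Substitute for the second derivative test, as \<open>u\<close> need not be twice
  differentiable. If \<open>g x0 > h x0\<close>, the flux difference starts at 0 and increases to
  the right of \<open>x0\<close>; so does \<open>u - w\<close>, against maximality. Working on one
  side only admits \<open>x0 = 0\<close>.\<close>

lemma flux_touch:
  fixes u w :: "real \<Rightarrow> real"
  assumes p: "p > 1" and x0: "x0 < b"
    and u: "\<And>x. x \<in> {x0..b} \<Longrightarrow> (u has_real_derivative v x) (at x within {x0..b})"
    and w: "\<And>x. x \<in> {x0..b} \<Longrightarrow> (w has_real_derivative z x) (at x within {x0..b})"
    and vz: "continuous_on {x0..b} v" "continuous_on {x0..b} z" "v x0 = z x0"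
    and g: "\<And>x. x \<in> {x0<..<b} \<Longrightarrow> ((\<lambda>t. phi p (v t)) has_real_derivative g x) (at x)"
    and h: "\<And>x. x \<in> {x0<..<b} \<Longrightarrow> ((\<lambda>t. phi p (z t)) has_real_derivative h x) (at x)"
    and gh: "continuous_on {x0..b} g" "continuous_on {x0..b} h"
    and max: "\<And>x. x \<in> {x0..b} \<Longrightarrow> u x - w x \<le> u x0 - w x0"
  shows "g x0 \<le> h x0"
proof (rule ccontr)
  assume "\<not> g x0 \<le> h x0"
  then have pos: "g x0 - h x0 > 0" by simp
  have "continuous_on {x0..b} (\<lambda>x. g x - h x)" using gh by (intro continuous_intros)
  then obtain d where d: "d > 0"
    and dd: "\<And>x. \<lbrakk>x \<in> {x0..b}; dist x x0 < d\<rbrakk> \<Longrightarrow> dist (g x - h x) (g x0 - h x0) < g x0 - h x0"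
    using pos x0 unfolding continuous_on_iff by (metis atLeastAtMost_iff less_imp_le order_refl)
  define y where "y = min (x0 + d/2) b"
  have y: "x0 < y" "y \<le> b" "y < x0 + d" using d x0 by (auto simp: y_def)
  have gh_pos: "g x - h x > 0" if "x0 < x" "x \<le> y" for x
    using dd[of x] that y by (auto simp: dist_real_def abs_if split: if_splits)
  have flux: "z x < v x" if x: "x0 < x" "x \<le> y" for x
  proof -
    have "phi p (v x0) - phi p (z x0) < phi p (v x) - phi p (z x)"
    proof (rule DERIV_pos_imp_increasing_open[OF x(1)])
      fix t assume t: "x0 < t" "t < x"
      have "((\<lambda>t. phi p (v t) - phi p (z t)) has_real_derivative g t - h t) (at t)"
        using t x y by (intro DERIV_diff g h) auto
      then show "\<exists>l. ((\<lambda>t. phi p (v t) - phi p (z t)) has_real_derivative l) (at t) \<and> 0 < l"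
        using gh_pos[of t] t x by auto
    next
      show "continuous_on {x0..x} (\<lambda>t. phi p (v t) - phi p (z t))"
        using x y by (intro continuous_intros p continuous_on_subset[OF vz(1)] continuous_on_subset[OF vz(2)]) auto
    qed
    then show ?thesis using vz(3) p by (simp add: phi_less_iff)
  qed
  have "u x0 - w x0 < u y - w y"
  proof (rule DERIV_pos_imp_increasing_open[OF y(1)])
    fix t assume t: "x0 < t" "t < y"
    have "((\<lambda>t. u t - w t) has_real_derivative v t - z t) (at t within {x0..b})"
      using t y by (intro DERIV_diff u w) auto
    then have "((\<lambda>t. u t - w t) has_real_derivative v t - z t) (at t)"
      using t y by (simp add: at_within_Icc_at)
    then show "\<exists>l. ((\<lambda>t. u t - w t) has_real_derivative l) (at t) \<and> 0 < l"
      using flux[of t] t by auto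
  next
    have "continuous_on {x0..b} u" "continuous_on {x0..b} w"
      by (rule DERIV_continuous_on[OF u], assumption, rule DERIV_continuous_on[OF w], assumption)
    then show "continuous_on {x0..y} (\<lambda>t. u t - w t)"
      using y by (intro continuous_intros) (auto elim: continuous_on_subset)
  qed
  then show False using max[of y] y by simp
qed

lemma periodic_comparison:
  assumes T: "T > 0" and p: "p > 1"
    and u: "periodic_flux T p u v g" and w: "periodic_flux T p w z h"
    and gh: "continuous_on {0..T} g" "continuous_on {0..T} h"
  obtains x0 where "x0 \<in> {0..<T}" "\<And>x. x \<in> {0..T} \<Longrightarrow> u x - w x \<le> u x0 - w x0" "g x0 \<le> h x0"
proof -
  have "continuous_on {0..T} (\<lambda>x. u x - w x)"
    using u w by (intro continuous_intros periodic_flux_continuous)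
  then obtain x1 where x1: "x1 \<in> {0..T}" "\<And>x. x \<in> {0..T} \<Longrightarrow> u x - w x \<le> u x1 - w x1"
    using continuous_attains_sup[of "{0..T}" "\<lambda>x. u x - w x"] T by auto
  \<comment> \<open>A maximum at \<open>T\<close> is moved to 0, where there is room to the
    right.\<close>
  define x0 where "x0 = (if x1 = T then 0 else x1)"
  have per: "u 0 - w 0 = u T - w T" "v 0 - z 0 = v T - z T" using u w by (auto simp: periodic_flux_def)
  have x0: "x0 \<in> {0..<T}" "\<And>x. x \<in> {0..T} \<Longrightarrow> u x - w x \<le> u x0 - w x0"
    using x1 T per(1) by (auto simp: x0_def)
  have sub: "{x0..T} \<subseteq> {0..T}" using x0 by auto
  have "v x0 - z x0 = 0"
  proof (rule periodic_max_deriv[OF T _ per])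
    show "((\<lambda>x. u x - w x) has_real_derivative v x - z x) (at x within {0..T})" if "x \<in> {0..T}" for x
      using u w that by (intro DERIV_diff) (auto simp: periodic_flux_def)
  qed (use x0 in auto)
  moreover have "(u has_real_derivative v x) (at x within {x0..T})" "(w has_real_derivative z x) (at x within {x0..T})"
    if "x \<in> {x0..T}" for x
    by (rule has_field_derivative_subset[OF _ sub]; use u w that sub in \<open>auto simp: periodic_flux_def\<close>)+
  ultimately have "g x0 \<le> h x0"
    using u w x0 gh unfolding periodic_flux_def
    by (intro flux_touch[OF p, of x0 T u v w z g h]) (auto intro: continuous_on_subset[OF _ sub])
  then show ?thesis using that x0 by blast
qed

text \<open>The bump is not periodic, so the touching point has to be interior.\<close>

lemma bump_comparison:
  assumes T: "T > 0" and p: "p > 1"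
    and a: "\<And>x. (a has_real_derivative va x) (at x)" "continuous_on UNIV va"
      "\<And>x. ((\<lambda>t. phi p (va t)) has_real_derivative ha x) (at x)" "continuous_on UNIV ha"
    and u: "periodic_flux T p u v g" and g: "continuous_on {0..T} g"
    and x0: "x0 \<in> {0<..<T}" and max: "\<And>x. x \<in> {0..T} \<Longrightarrow> a x - u x \<le> a x0 - u x0"
  shows "ha x0 \<le> g x0"
proof -
  have sub: "{x0..T} \<subseteq> {0..T}" using x0 by auto
  have aw: "(a has_real_derivative va x) (at x within S)" for x S
    using a(1) by (rule has_field_derivative_at_within)
  have d: "((\<lambda>x. a x - u x) has_real_derivative va x - v x) (at x within {0..T})" if "x \<in> {0..T}" for x
    using u that by (intro DERIV_diff aw) (auto simp: periodic_flux_def)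
  have x0': "x0 \<in> {0..T}" "0 < x0" "x0 < T" "0 \<le> x0" "x0 \<le> T" using x0 by auto
  have "va x0 - v x0 = 0"
    using deriv_max_right[OF d[OF x0'(1)] x0'(4,3)] deriv_max_left[OF d[OF x0'(1)] x0'(2,5)] max by (meson antisym)
  moreover have "(u has_real_derivative v x) (at x within {x0..T})" if "x \<in> {x0..T}" for x
    by (rule has_field_derivative_subset[OF _ sub]) (use u that sub in \<open>auto simp: periodic_flux_def\<close>)
  ultimately show ?thesis
    using u x0 a(3) g max unfolding periodic_flux_def
    by (intro flux_touch[OF p, of x0 T a va u v ha g])
       (auto intro: aw continuous_on_subset[OF _ sub] continuous_on_subset[OF a(2)] continuous_on_subset[OF a(4)])
qed

section \<open>Construction of the barriers\<close>

lemma periodic_flux_scale: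
  assumes "periodic_flux T p u v g"
  shows "periodic_flux T p (\<lambda>x. s * u x) (\<lambda>x. s * v x) (\<lambda>x. phi p s * g x)"
  using assms unfolding periodic_flux_def phi_mult
  by (auto intro!: continuous_intros DERIV_cmult)

text \<open>
  The witness is \<open>1 + \<eta> Y\<close> with \<open>Y\<close> periodic, \<open>(phi p Y')' = q - c\<close> and \<open>c\<close> the mean of \<open>q\<close>.
\<close>

lemma supersolution_exists:
  assumes T: "T > 0" and p: "p > 1" and q: "continuous_on {0..T} q" "\<And>x. x \<in> {0..T} \<Longrightarrow> q x \<ge> 0"
    and q0: "\<exists>x\<in>{0..T}. q x \<noteq> 0"
  obtains e v h k where "k > 0" "periodic_flux T p e v h" "continuous_on {0..T} h"
    "\<And>x. x \<in> {0..T} \<Longrightarrow> 1/2 \<le> e x \<and> e x \<le> 3/2 \<and> h x \<le> q x * phi p (e x) - k"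
proof -
  let ?\<psi> = "phi (dual_exp p)"
  have p': "dual_exp p > 1" using p by (rule dual_exp_gt_1)
  define c where "c = integral {0..T} q / T"
  have "integral {0..T} q \<noteq> 0"
    using integral_eq_0_iff[of 0 T q] q q0 T by auto
  moreover have "integral {0..T} q \<ge> 0" using q by (intro integral_nonneg integrable_continuous_real) auto
  ultimately have c: "c > 0" using T by (simp add: c_def)
  define H where "H = primitive T 0 q"
  have H: "(H has_real_derivative q x - c) (at x within {0..T})" if "x \<in> {0..T}" for x
    unfolding H_def c_def by (rule primitive_deriv[OF T q(1) that])
  have H0: "H 0 = 0" "H T = 0" using T by (simp_all add: H_def primitive_ends)
  have Hc: "continuous_on {0..T} H" using H by (rule DERIV_continuous_on)
  then have "bounded (H ` {0..T})" by (intro compact_imp_bounded compact_continuous_image) auto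
  then obtain M where "\<forall>y\<in>H ` {0..T}. norm y \<le> M" unfolding bounded_iff by blast
  then have M: "\<bar>H x\<bar> \<le> M" if "x \<in> {0..T}" for x using that by auto
  have M0: "M \<ge> 0" using M[of 0] T by auto
  \<comment> \<open>The constant of integration \<open>a\<close> must give the derivative of
    \<open>Y\<close> mean zero. It comes from the intermediate value theorem, since
    \<open>a + H\<close> has constant sign for \<open>a = - M\<close> and for
    \<open>a = M\<close>.\<close>
  define J where "J a = integral {0..T} (\<lambda>x. ?\<psi> (a + H x))" for a
  have inc: "continuous_on {0..T} (\<lambda>x. ?\<psi> (a + H x))" for a
    using Hc by (intro continuous_on_phi p' continuous_intros)
  have "continuous_on ({-M..M} \<times> cbox 0 T) (\<lambda>(a, x). ?\<psi> (a + H x))"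
    unfolding case_prod_unfold
    by (intro continuous_on_phi p' continuous_intros continuous_on_compose2[OF Hc]) auto
  then have "continuous_on {-M..M} J"
    using integral_continuous_on_param[of "{-M..M}" 0 T "\<lambda>a x. ?\<psi> (a + H x)"] by (simp add: J_def[abs_def])
  moreover have "J (- M) \<le> 0"
  proof -
    have "J (- M) \<le> integral {0..T} (\<lambda>_. 0)"
      unfolding J_def using M by (intro integral_le integrable_continuous_real inc phi_nonpos p') (auto simp: abs_le_iff)
    then show ?thesis by simp
  qed
  moreover have "J M \<ge> 0"
    unfolding J_def using M by (intro integral_nonneg integrable_continuous_real inc phi_nonneg p') (force simp: abs_le_iff)
  ultimately obtain a where a: "J a = 0" using IVT'[of J "- M" 0 M] M0 by auto
  define y where "y x = ?\<psi> (a + H x)" for x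
  define Y where "Y = primitive T 0 y"
  have yc: "continuous_on {0..T} y" unfolding y_def by (rule inc)
  have Y: "(Y has_real_derivative y x) (at x within {0..T})" if "x \<in> {0..T}" for x
  proof -
    have "integral {0..T} y = 0" using a by (simp add: J_def y_def[abs_def])
    then show ?thesis using primitive_deriv[OF T yc that, of 0] by (simp add: Y_def)
  qed
  have Yc: "continuous_on {0..T} Y" using Y by (rule DERIV_continuous_on)
  then have "bounded (Y ` {0..T})" by (intro compact_imp_bounded compact_continuous_image) auto
  then obtain N where "\<forall>y\<in>Y ` {0..T}. norm y \<le> N" unfolding bounded_iff by blast
  then have N: "\<bar>Y x\<bar> \<le> N" if "x \<in> {0..T}" for x using that by auto
  have N0: "N \<ge> 0" using N[of 0] T by auto
  \<comment> \<open>\<open>\<eta> * N \<le> 1/2\<close> keeps the function between 1/2 and 3/2, and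
    \<open>\<eta> \<le> 1/2\<close> places \<open>\<eta>\<close> itself below it.\<close>
  define \<eta> where "\<eta> = 1 / (2 * (N + 1))"
  have \<eta>: "\<eta> > 0" "\<eta> \<le> 1/2" "\<eta> * N \<le> 1/2" using N0 by (auto simp: \<eta>_def field_simps)
  have \<eta>Y: "\<bar>\<eta> * Y x\<bar> \<le> 1/2" if "x \<in> {0..T}" for x
  proof -
    have "\<eta> * \<bar>Y x\<bar> \<le> \<eta> * N" using N[OF that] \<eta> by (intro mult_left_mono) auto
    moreover have "\<bar>\<eta> * Y x\<bar> = \<eta> * \<bar>Y x\<bar>" using \<eta> by (simp add: abs_mult)
    ultimately show ?thesis using \<eta>(3) by linarith
  qed
  show ?thesis
  proof (rule that[of "phi p \<eta> * c" "\<lambda>x. 1 + \<eta> * Y x" "\<lambda>x. \<eta> * y x" "\<lambda>x. phi p \<eta> * (q x - c)"])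
    show "phi p \<eta> * c > 0" using phi_pos[OF p \<eta>(1)] c by simp
    show "continuous_on {0..T} (\<lambda>x. phi p \<eta> * (q x - c))" using q by (intro continuous_intros)
    show "periodic_flux T p (\<lambda>x. 1 + \<eta> * Y x) (\<lambda>x. \<eta> * y x) (\<lambda>x. phi p \<eta> * (q x - c))"
      unfolding periodic_flux_def
    proof (intro conjI ballI)
      show "((\<lambda>x. 1 + \<eta> * Y x) has_real_derivative \<eta> * y x) (at x within {0..T})" if "x \<in> {0..T}" for x
        using Y[OF that] by (auto intro!: derivative_eq_intros)
      show "continuous_on {0..T} (\<lambda>x. \<eta> * y x)" using yc by (intro continuous_intros)
      fix x assume x: "x \<in> {0<..<T}"
      have "(H has_real_derivative q x - c) (at x)" using H[of x] x by (simp add: at_within_Icc_at)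
      then show "((\<lambda>t. phi p (\<eta> * y t)) has_real_derivative phi p \<eta> * (q x - c)) (at x)"
        unfolding phi_mult y_def phi_phi_dual[OF p] by (auto intro!: derivative_eq_intros)
    qed (use T H0 in \<open>auto simp: Y_def primitive_ends y_def\<close>)
    fix x assume x: "x \<in> {0..T}"
    have e: "1/2 \<le> 1 + \<eta> * Y x" "1 + \<eta> * Y x \<le> 3/2" using \<eta>Y[OF x] by (auto simp: abs_le_iff)
    \<comment> \<open>Since the function is at least \<open>\<eta>\<close>, its potential term
      absorbs \<open>phi p \<eta> * q x\<close>, which leaves the gain
      \<open>phi p \<eta> * c\<close>.\<close>
    have "phi p \<eta> \<le> phi p (1 + \<eta> * Y x)" using e \<eta> p by (simp add: phi_le_iff)
    then have "q x * phi p \<eta> \<le> q x * phi p (1 + \<eta> * Y x)" using q(2)[OF x] by (rule mult_left_mono)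
    then show "1/2 \<le> 1 + \<eta> * Y x \<and> 1 + \<eta> * Y x \<le> 3/2 \<and>
        phi p \<eta> * (q x - c) \<le> q x * phi p (1 + \<eta> * Y x) - phi p \<eta> * c"
      using e by (simp add: algebra_simps)
  qed
qed

lemma phi_times_self: "phi b y * y = \<bar>y\<bar> powr b"
proof -
  have "\<bar>y\<bar> powr (b - 2) * (\<bar>y\<bar> * \<bar>y\<bar>) = \<bar>y\<bar> powr b" if "y \<noteq> 0"
    using that by (simp add: powr_diff power2_eq_square)
  then show ?thesis by (cases "y = 0") (auto simp: phi_def mult.assoc)
qed

lemma DERIV_abs_powr:
  assumes b: "b > 1"
  shows "((\<lambda>t. \<bar>t\<bar> powr b) has_real_derivative b * phi b y) (at y)"
proof -
  consider "y > 0" | "y < 0" | "y = 0" by linarith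
  then show ?thesis
  proof cases
    case 1
    have "((\<lambda>t. t powr b) has_real_derivative b * phi b y) (at y)"
      using 1 b by (auto intro!: derivative_eq_intros simp: phi_nonneg_eq)
    then show ?thesis
      by (rule has_field_derivative_transform_within_open[of _ _ _ "{0<..}"]) (use 1 in auto)
  next
    case 2
    have "phi b y = - ((- y) powr (b - 1))" using 2 phi_nonneg_eq[OF b, of "- y"] by simp
    then have "((\<lambda>t. (- t) powr b) has_real_derivative b * phi b y) (at y)"
      using 2 b by (auto intro!: derivative_eq_intros)
    then show ?thesis
      by (rule has_field_derivative_transform_within_open[of _ _ _ "{..<0}"]) (use 2 in auto)
  next
    case 3
    \<comment> \<open>At 0 the difference quotient of the power is \<open>phi b\<close>
      itself.\<close>
    have "isCont (phi b) 0"
      using continuous_on_phi[OF b continuous_on_id, of UNIV] by (simp add: continuous_on_eq_continuous_at)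
    then have "phi b \<midarrow>0\<rightarrow> 0" by (simp add: isCont_def)
    then have "(\<lambda>h. (\<bar>0 + h\<bar> powr b - \<bar>0\<bar> powr b) / h) \<midarrow>0\<rightarrow> 0"
      by (rule Lim_transform_eventually)
         (auto simp: eventually_at_filter b simp flip: phi_times_self)
    then show ?thesis using 3 by (simp add: DERIV_def)
  qed
qed

text \<open>An exponential barrier in \<open>\<bar>x - c\<bar> powr b\<close>. With \<open>b\<close>
  conjugate to \<open>p\<close>, the flux of the power is linear in \<open>x - c\<close>, hence
  smooth at the centre for every \<open>p > 1\<close>. Strict positivity of \<open>ha\<close> at the
  zeros of \<open>a\<close> matters because \<open>f (a x)\<close> vanishes there and no large
  \<open>lam\<close> can help.\<close>

lemma bump_exists:
  assumes p: "p > 1" and r: "r > 0"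
  obtains a va ha :: "real \<Rightarrow> real" where
    "\<And>x. (a has_real_derivative va x) (at x)" "continuous_on UNIV va"
    "\<And>x. ((\<lambda>t. phi p (va t)) has_real_derivative ha x) (at x)" "continuous_on UNIV ha"
    "\<And>x. a x \<le> 1" "a c > 0" "\<And>x. a x \<ge> 0 \<Longrightarrow> \<bar>x - c\<bar> \<le> r" "\<And>x. a x = 0 \<Longrightarrow> ha x > 0"
proof -
  define b where "b = dual_exp p"
  have b: "b > 1" "b * (p - 1) = p" using p by (auto simp: b_def dual_exp_def)
  define N where "N x = \<bar>x - c\<bar> powr b" for x
  \<comment> \<open>Chosen so that the factor \<open>1 - k * p * N x\<close> in \<open>ha\<close>
    equals -1 where \<open>a\<close> vanishes, that is at distance \<open>r\<close> from
    \<open>c\<close>.\<close>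
  define k where "k = 2 / (p * r powr b)"
  have k: "k > 0" "k * (p * r powr b) = 2" using p r by (auto simp: k_def)
  define a where "a x = exp (- k * N x) - exp (- k * r powr b)" for x
  define va where "va x = - k * b * phi b (x - c) * exp (- k * N x)" for x
  define K where "K = phi p (k * b)"
  define ha where "ha x = - K * (1 - k * p * N x) * exp (- k * (p - 1) * N x)" for x
  have K: "K > 0" unfolding K_def using k b by (intro phi_pos p) auto
  have N: "(N has_real_derivative b * phi b (x - c)) (at x)" for x
    using DERIV_shift[of "\<lambda>t. \<bar>t\<bar> powr b" "b * phi b (x - c)" "x" "- c"] DERIV_abs_powr[OF b(1), of "x - c"]
    by (simp add: N_def[abs_def])
  have Nc: "continuous_on S N" for S
    using N by (meson DERIV_continuous_on has_field_derivative_at_within)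
  have ph: "phi p (va x) = - K * (x - c) * exp (- k * (p - 1) * N x)" for x
  proof -
    have "phi p (exp (- k * N x)) = exp (- k * (p - 1) * N x)"
      using p by (simp add: phi_nonneg_eq powr_def algebra_simps)
    moreover have "phi p (phi b (x - c)) = x - c" unfolding b_def by (rule phi_phi_dual[OF p])
    moreover have "va x = - (k * b * phi b (x - c) * exp (- k * N x))" by (simp add: va_def)
    ultimately show ?thesis by (simp only: phi_minus phi_mult K_def) simp
  qed
  show ?thesis
  proof (rule that[of a va ha])
    show "(a has_real_derivative va x) (at x)" for x
      unfolding a_def va_def by (auto intro!: derivative_eq_intros N)
    show "continuous_on UNIV va" "continuous_on UNIV ha"
      unfolding va_def ha_def using b by (auto intro!: continuous_intros Nc)
    show "((\<lambda>t. phi p (va t)) has_real_derivative ha x) (at x)" for x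
    proof -
      have "((\<lambda>t. - K * (t - c) * exp (- k * (p - 1) * N t)) has_real_derivative
          - K * exp (- k * (p - 1) * N x) + - K * (x - c) * (- k * (p - 1) * (b * phi b (x - c)) * exp (- k * (p - 1) * N x))) (at x)"
        by (auto intro!: derivative_eq_intros N)
      moreover have "- K * exp (- k * (p - 1) * N x) + - K * (x - c) * (- k * (p - 1) * (b * phi b (x - c)) * exp (- k * (p - 1) * N x))
          = - K * (1 - k * (b * (p - 1)) * (phi b (x - c) * (x - c))) * exp (- k * (p - 1) * N x)"
        by (simp add: algebra_simps)
      ultimately show ?thesis unfolding ph ha_def b(2) phi_times_self N_def by simp
    qed
    show "a x \<le> 1" for x
    proof -
      have "exp (- k * N x) \<le> 1" using k by (simp add: N_def)
      then show ?thesis unfolding a_def using exp_ge_zero[of "- k * r powr b"] by linarith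
    qed
    show "a c > 0" using k r by (simp add: a_def N_def)
    show "\<bar>x - c\<bar> \<le> r" if "a x \<ge> 0" for x
    proof (rule ccontr)
      assume "\<not> \<bar>x - c\<bar> \<le> r"
      then have "r powr b < N x" unfolding N_def using r b by (intro powr_less_mono2) auto
      then show False using that k by (simp add: a_def)
    qed
    show "ha x > 0" if "a x = 0" for x
    proof -
      have "N x = r powr b" using that k by (simp add: a_def)
      then have "1 - k * p * N x = -1" using k(2) by (simp add: mult.assoc)
      then show ?thesis unfolding ha_def using K by simp
    qed
  qed
qed

section \<open>Strong maximum principle\<close>

text \<open>
  No uniqueness theorem for initial value problems applies, since \<open>phi\<close> is not Lipschitz. But on an
  interval of length \<open>h\<close> the maximum \<open>U\<close> of \<open>u\<close> satisfies \<open>U \<le> \<theta> U\<close> with \<open>\<theta> < 1\<close>, because \<open>g\<close> is controlled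
  by a function homogeneous of the same degree.
\<close>

lemma zero_propagates:
  assumes T: "T > 0" and p: "p > 1" and u: "periodic_flux T p u v g"
    and nn: "\<And>x. x \<in> {0..T} \<Longrightarrow> u x \<ge> 0"
    and g: "\<And>x. x \<in> {0..T} \<Longrightarrow> \<bar>g x\<bar> \<le> C * phi p (u x)" and C: "C > 0"
    and x0: "x0 \<in> {0..T}" "u x0 = 0" "v x0 = 0" and y: "y \<in> {x0..T}"
  shows "u y = 0 \<and> v y = 0"
proof -
  let ?\<psi> = "phi (dual_exp p)"
  have p': "dual_exp p > 1" using p by (rule dual_exp_gt_1)
  have vc: "continuous_on {0..T} v" and uc: "continuous_on {0..T} u"
    using u periodic_flux_continuous by (auto simp: periodic_flux_def)
  \<comment> \<open>\<open>C * h \<le> 1/2\<close> halves the bound on the flux, which becomes the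
    factor \<open>\<theta>\<close> for \<open>v\<close>; \<open>h \<le> 1\<close> keeps that factor
    when \<open>v\<close> is integrated.\<close>
  define h where "h = min 1 (1 / (2 * C))"
  have h: "0 < h" "h \<le> 1" "C * h \<le> 1/2" using C by (auto simp: h_def min_def field_simps)
  define \<theta> where "\<theta> = ?\<psi> (1/2)"
  have \<theta>: "0 \<le> \<theta>" "\<theta> < 1" using phi_less_iff[OF p', of "1/2" 1] phi_nonneg[OF p', of "1/2"] by (auto simp: \<theta>_def)
  have step: "u t = 0 \<and> v t = 0"
    if s: "s \<in> {0..T}" "u s = 0" "v s = 0" and t: "s \<le> t" "t \<le> s + h" "t \<le> T" for s t
  proof -
    have sub: "{s..t} \<subseteq> {0..T}" using s t by auto
    obtain x1 where x1: "x1 \<in> {s..t}" "\<And>x. x \<in> {s..t} \<Longrightarrow> u x \<le> u x1"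
      using continuous_attains_sup[of "{s..t}" u] t continuous_on_subset[OF uc sub] by auto
    define U where "U = u x1"
    have U: "U \<ge> 0" using nn x1 sub by (auto simp: U_def)
    have v: "\<bar>v x\<bar> \<le> \<theta> * U" if x: "x \<in> {s..t}" for x
    proof (cases "x = s")
      case True
      then show ?thesis using s \<theta> U by simp
    next
      case False
      then have sx: "s < x" using x by simp
      have "continuous_on {s..x} (\<lambda>t. phi p (v t))"
        using x sub by (intro continuous_on_phi p continuous_on_subset[OF vc]) auto
      moreover have "((\<lambda>t. phi p (v t)) has_derivative (\<lambda>r. r * g z)) (at z)" if "s < z" "z < x" for z
        using u that x s t by (auto simp: periodic_flux_def has_field_derivative_def mult_commute_abs)
      ultimately obtain z where z: "s < z" "z < x" "phi p (v x) - phi p (v s) = (x - s) * g z"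
        using mvt[OF sx, of "\<lambda>t. phi p (v t)" "\<lambda>z r. r * g z"] by blast
      have zT: "z \<in> {0..T}" "z \<in> {s..t}" using z x s t by auto
      have "phi p \<bar>v x\<bar> = (x - s) * \<bar>g z\<bar>" using z s sx by (simp add: abs_mult flip: abs_phi)
      also have "\<dots> \<le> h * (C * phi p U)"
        using g[OF zT(1)] x t sx x1(2)[OF zT(2)] C h phi_le_iff[OF p, of "u z" U]
        by (intro mult_mono order.trans[OF g[OF zT(1)] mult_left_mono]) (auto simp: U_def)
      also have "\<dots> = (C * h) * phi p U" by simp
      also have "\<dots> \<le> 1/2 * phi p U" using h phi_nonneg[OF p U] by (intro mult_right_mono)
      also have "\<dots> = phi p (\<theta> * U)" unfolding phi_mult \<theta>_def phi_phi_dual[OF p] by simp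
      finally show ?thesis by (simp add: phi_le_iff p)
    qed
    have "U \<le> \<theta> * U"
    proof (cases "x1 = s")
      case True
      then show ?thesis using s by (simp add: U_def)
    next
      case False
      then have sx: "s < x1" using x1 by simp
      have "continuous_on {s..x1} u" using x1 sub by (intro continuous_on_subset[OF uc]) auto
      moreover have "(u has_derivative (\<lambda>r. r * v z)) (at z)" if "s < z" "z < x1" for z
      proof -
        have "z \<in> {0<..<T}" using that s t x1 by auto
        moreover from this have "(u has_real_derivative v z) (at z within {0..T})"
          using u by (auto simp: periodic_flux_def)
        ultimately have "(u has_real_derivative v z) (at z)" by (simp add: at_within_Icc_at)
        then show ?thesis by (simp add: has_field_derivative_def mult_commute_abs)
      qed
      ultimately obtain z where z: "s < z" "z < x1" "u x1 - u s = (x1 - s) * v z"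
        using mvt[OF sx, of u "\<lambda>z r. r * v z"] by blast
      have "U \<le> (x1 - s) * \<bar>v z\<bar>" using z s sx by (simp add: U_def mult_left_mono)
      also have "\<dots> \<le> 1 * (\<theta> * U)"
        using v[of z] z x1 t h sx by (intro mult_mono) auto
      finally show ?thesis by simp
    qed
    then have "U * (1 - \<theta>) \<le> 0" by (simp add: algebra_simps)
    then have "U = 0" using U \<theta> by (simp add: mult_le_0_iff)
    moreover have "u t \<le> U" "u t \<ge> 0" using x1(2)[of t] nn[of t] s t by (auto simp: U_def)
    ultimately show ?thesis using v[of t] t by auto
  qed
  have "\<forall>t\<in>{x0..min T (x0 + real n * h)}. u t = 0 \<and> v t = 0" for n
  proof (induction n)
    case 0
    then show ?case using x0 by (auto simp: min_def split: if_splits)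
  next
    case (Suc n)
    show ?case
    proof
      fix t assume t: "t \<in> {x0..min T (x0 + real (Suc n) * h)}"
      define s where "s = min t (x0 + real n * h)"
      have "s \<in> {x0..min T (x0 + real n * h)}" using t h by (auto simp: s_def)
      then have "u s = 0" "v s = 0" using Suc by auto
      moreover have "t \<le> T" "t \<le> x0 + real n * h + h" "x0 \<le> t" using t by (auto simp: algebra_simps)
      ultimately show "u t = 0 \<and> v t = 0"
        using x0 h by (intro step[of s t]) (auto simp: s_def min_def split: if_splits)
    qed
  qed
  moreover obtain n where "y - x0 \<le> real n * h"
    using real_arch_simple[of "(y - x0) / h"] h by (auto simp: field_simps)
  ultimately show ?thesis using y by (metis atLeastAtMost_iff diff_le_eq add.commute min.bounded_iff)
qed

text \<open>A zero of a nonnegative function is a minimum, so the slope vanishes too. Zeros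
  propagate to the right up to \<open>T\<close>, reappear at 0 by periodicity, and from there fill
  the period.\<close>

lemma nonneg_solution_positive:
  assumes T: "T > 0" and p: "p > 1" and u: "periodic_flux T p u v g"
    and nn: "\<And>x. x \<in> {0..T} \<Longrightarrow> u x \<ge> 0"
    and g: "\<And>x. x \<in> {0..T} \<Longrightarrow> \<bar>g x\<bar> \<le> C * phi p (u x)" and C: "C > 0"
    and ex: "\<exists>x\<in>{0..T}. u x > 0" and x: "x \<in> {0..T}"
  shows "u x > 0"
proof (rule ccontr)
  assume "\<not> u x > 0"
  then have ux: "u x = 0" using nn[OF x] by simp
  have per: "u 0 = u T" "v 0 = v T" using u by (auto simp: periodic_flux_def)
  have "- v x = 0"
  proof (rule periodic_max_deriv[OF T, of "\<lambda>x. - u x" "\<lambda>x. - v x"])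
    show "((\<lambda>x. - u x) has_real_derivative - v x) (at x within {0..T})" if "x \<in> {0..T}" for x
      using u that by (intro DERIV_minus) (auto simp: periodic_flux_def)
  qed (use per x ux nn in auto)
  then have vx: "v x = 0" by simp
  have zp: "u y = 0 \<and> v y = 0" if "x0 \<in> {0..T}" "u x0 = 0" "v x0 = 0" "y \<in> {x0..T}" for x0 y
    by (rule zero_propagates[OF T p u nn g C that])
  have "u T = 0 \<and> v T = 0" using zp[OF x ux vx, of T] x by auto
  then have "u 0 = 0" "v 0 = 0" using per by auto
  then have "u y = 0" if "y \<in> {0..T}" for y using zp[of 0 y] that T by auto
  then show False using ex by force
qed

section \<open>Truncation, homotopy and the two solutions\<close>

lemma continuous_on_composite_fst:
  "continuous_on I q \<Longrightarrow> continuous_on (J \<times> I \<times> K) (\<lambda>z. q (fst (snd z)))"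
  by (rule continuous_on_compose2[of I q]) (auto intro!: continuous_intros)

text \<open>With \<open>\<bar>m x\<bar>\<close> in their inequalities, \<open>b1\<close> and
  \<open>b2\<close> are strict supersolutions for every damping of the nonlinearity, whatever the
  sign of \<open>m\<close>. The inequality for \<open>a\<close> is needed only where
  \<open>a \<ge> 0\<close>: solutions are nonnegative, so they can touch \<open>a\<close> from above
  nowhere else.\<close>

theorem two_solutions_between_barriers:
  fixes T p lam :: real and q m f :: "real \<Rightarrow> real"
  assumes T: "T > 0" and p: "p > 1"
    and q: "continuous_on {0..T} q" "\<And>x. x \<in> {0..T} \<Longrightarrow> q x \<ge> 0"
    and m: "continuous_on {0..T} m"
    and f: "continuous_on UNIV f" "f 0 = 0" "\<And>s. s > 0 \<Longrightarrow> f s > 0" and lam: "lam > 0"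
    and b1: "periodic_flux T p b1 w1 h1" "continuous_on {0..T} h1" "\<And>x. x \<in> {0..T} \<Longrightarrow> b1 x > 0"
      "\<And>x. x \<in> {0..T} \<Longrightarrow> h1 x < q x * phi p (b1 x) - lam * \<bar>m x\<bar> * f (b1 x)"
    and b2: "periodic_flux T p b2 w2 h2" "continuous_on {0..T} h2" "\<And>x. x \<in> {0..T} \<Longrightarrow> b2 x > 0"
      "\<And>x. x \<in> {0..T} \<Longrightarrow> h2 x < q x * phi p (b2 x) - lam * \<bar>m x\<bar> * f (b2 x)"
    and a: "\<And>x. (a has_real_derivative va x) (at x)" "continuous_on UNIV va"
      "\<And>x. ((\<lambda>t. phi p (va t)) has_real_derivative ha x) (at x)" "continuous_on UNIV ha"
      "\<And>x. x \<in> {0..T} \<Longrightarrow> a x \<le> b2 x" "\<exists>x\<in>{0..T}. b1 x < a x"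
      "\<And>x. \<lbrakk>x \<in> {0..T}; a x \<ge> 0\<rbrakk> \<Longrightarrow> x \<in> {0<..<T} \<and> m x > 0 \<and> q x * phi p (a x) - lam * m x * f (a x) < ha x"
  obtains u v u' v' where
    "periodic_flux T p u v (\<lambda>x. q x * phi p (u x) - lam * m x * f (u x))"
    "\<forall>x\<in>{0..T}. 0 \<le> u x" "\<forall>x\<in>{0..T}. a x \<le> u x"
    "periodic_flux T p u' v' (\<lambda>x. q x * phi p (u' x) - lam * m x * f (u' x))"
    "\<forall>x\<in>{0..T}. 0 \<le> u' x" "\<exists>x\<in>{0..T}. b1 x < u' x" "\<exists>x\<in>{0..T}. u' x < a x"
proof -
  define c where "c x y = max 0 (min y (b2 x))" for x y
  \<comment> \<open>For \<open>s = 0\<close> this is the original equation. Decreasing \<open>s\<close> to \<open>-1\<close> switches off the nonlinearity,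
    which leaves only solutions below \<open>b1\<close>; increasing it to \<open>1\<close> replaces \<open>u\<close> by \<open>max u a\<close> in \<open>f\<close>, which makes
    all solutions lie above \<open>a\<close>, but does not affect the equation for solutions above \<open>a\<close>.\<close>
  define H where "H s x y = q x * phi p y - lam * m x * min 1 (1 + s) * f (max y (max 0 s * max 0 (a x)))" for s x y
  \<comment> \<open>Truncation to values between 0 and \<open>b2 x\<close> bounds the right-hand
    side. The clipped excess is positive above \<open>b2\<close> and negative below 0, so it
    contradicts the comparison at an extremum outside this range.\<close>
  define G where "G s x y = H s x (c x y) + max (- 1) (min 1 (y - c x y))" for s x y
  let ?I = "{0..T}" and ?J = "{-1..1::real}"
  have b1c: "continuous_on ?I b1" and b2c: "continuous_on ?I b2"
    using b1(1) b2(1) by (auto intro: periodic_flux_continuous)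
  have ac: "continuous_on S a" for S using a(1) by (meson DERIV_continuous_on has_field_derivative_at_within)
  have fnn: "f s \<ge> 0" if "s \<ge> 0" for s using f(2) f(3)[of s] that by (cases "s = 0") auto
  have damped: "lam * m x * min 1 (1 + s) * f y \<le> lam * \<bar>m x\<bar> * f y" if "s \<in> {-1..1}" "y \<ge> 0" for s x y
  proof -
    have "\<bar>m x * min 1 (1 + s)\<bar> \<le> \<bar>m x\<bar> * 1"
      unfolding abs_mult using that by (intro mult_left_mono) auto
    then have "m x * min 1 (1 + s) \<le> \<bar>m x\<bar>" by linarith
    then have "lam * (m x * min 1 (1 + s)) * f y \<le> lam * \<bar>m x\<bar> * f y"
      using lam that fnn by (intro mult_right_mono mult_left_mono) auto
    then show ?thesis by (simp only: mult.assoc)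
  qed
  note cf = continuous_on_composite_fst
  have Hc: "continuous_on (?J \<times> ?I \<times> UNIV) (\<lambda>(s, x, y). H s x y)"
    unfolding H_def case_prod_unfold
    by (intro continuous_intros cf q m ac p continuous_on_compose2[OF f(1)]) auto
  have cc: "continuous_on (?J \<times> ?I \<times> UNIV) (\<lambda>(s, x, y). c x y)"
    unfolding c_def case_prod_unfold by (intro continuous_intros cf b2c)
  have cc': "continuous_on (?J \<times> ?I \<times> UNIV) (\<lambda>z. c (fst (snd z)) (snd (snd z)))"
    using cc by (simp add: case_prod_unfold)
  then have *: "continuous_on (?J \<times> ?I \<times> UNIV) (\<lambda>z. (fst z, fst (snd z), c (fst (snd z)) (snd (snd z))))"
    by (intro continuous_intros)
  have "continuous_on (?J \<times> ?I \<times> UNIV)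
      (\<lambda>z. (\<lambda>(s, x, y). H s x y) (fst z, fst (snd z), c (fst (snd z)) (snd (snd z))))"
    by (rule continuous_on_compose2[OF Hc *]) auto
  then have Gc: "continuous_on (?J \<times> ?I \<times> UNIV) (\<lambda>(s, x, y). G s x y)"
    unfolding G_def case_prod_unfold fst_conv snd_conv by (intro continuous_intros cc')
  have "bounded (b2 ` ?I)" by (intro compact_imp_bounded compact_continuous_image b2c) auto
  then obtain R where "\<forall>y\<in>b2 ` ?I. norm y \<le> R" unfolding bounded_iff by blast
  then have R: "\<bar>b2 x\<bar> \<le> R" if "x \<in> ?I" for x using that by auto
  have R0: "R \<ge> 0" using R[of 0] T by auto
  have c: "0 \<le> c x y" "c x y \<le> R" if "x \<in> ?I" for x y using R[OF that] R0 by (auto simp: c_def)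
  have "bounded ((\<lambda>(s, x, y). H s x y) ` (?J \<times> ?I \<times> {0..R}))"
    by (intro compact_imp_bounded compact_continuous_image continuous_on_subset[OF Hc] compact_Times) auto
  then obtain B where "\<forall>y\<in>(\<lambda>(s, x, y). H s x y) ` (?J \<times> ?I \<times> {0..R}). norm y \<le> B" unfolding bounded_iff by blast
  then have HB: "\<bar>H s x y\<bar> \<le> B" if "s \<in> ?J" "x \<in> ?I" "y \<in> {0..R}" for s x y using that by force
  have GB: "\<bar>G s x y\<bar> \<le> B + 1" if "s \<in> ?J" "x \<in> ?I" for s x y
    using HB[OF that, of "c x y"] c[OF that(2)] by (auto simp: G_def)
  have gcont: "continuous_on ?I (\<lambda>x. G s x (u x) - k)" if "s \<in> ?J" "periodic_flux T p u v g" for s u v g k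
  proof -
    have *: "continuous_on ?I (\<lambda>x. (s, x, u x))"
      using periodic_flux_continuous[OF that(2)] by (intro continuous_intros)
    have "continuous_on ?I (\<lambda>x. (\<lambda>(s, x, y). G s x y) (s, x, u x))"
      by (rule continuous_on_compose2[OF Gc *]) (use that(1) in auto)
    then show ?thesis unfolding case_prod_conv by (intro continuous_intros)
  qed
  have zero: "periodic_flux T p (\<lambda>_. 0) (\<lambda>_. 0) (\<lambda>_. 0)" by (simp add: periodic_flux_def)
  have lower: "\<forall>x\<in>?I. u x \<ge> 0"
    if s: "s \<in> ?J" and u: "periodic_flux T p u v (\<lambda>x. G s x (u x) - k)" and k: "k \<ge> 0" for s u v k
  proof -
    obtain x0 where x0: "x0 \<in> {0..<T}" "\<And>x. x \<in> ?I \<Longrightarrow> 0 - u x \<le> 0 - u x0" "0 \<le> G s x0 (u x0) - k"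
      using periodic_comparison[OF T p zero u _ gcont[OF s u]] by (metis continuous_on_const)
    have "u x0 \<ge> 0"
    proof (rule ccontr)
      assume neg: "\<not> u x0 \<ge> 0"
      have x0I: "x0 \<in> ?I" using x0 by auto
      have "c x0 (u x0) = 0" using neg b2(3)[OF x0I] by (simp add: c_def)
      moreover have "0 \<le> lam * m x0 * min 1 (1 + s) * f (max 0 (max 0 s * max 0 (a x0)))"
      \<comment> \<open>For \<open>s > 0\<close> the modified nonlinearity need not vanish at
        negative values; where it does not, \<open>a\<close> is positive and hence so is
        \<open>m\<close>.\<close>
      proof (cases "a x0 \<ge> 0")
        case True
        then have "m x0 > 0" using a(7)[OF x0I] by blast
        then show ?thesis using s lam by (intro mult_nonneg_nonneg fnn) auto
      next
        case False
        then show ?thesis using f(2) by simp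
      qed
      ultimately have "G s x0 (u x0) < 0" using neg by (simp add: G_def H_def)
      then show False using x0(3) k by simp
    qed
    then show ?thesis using x0(2) by force
  qed
  have upper: "\<forall>x\<in>?I. u x \<le> b2 x"
    if s: "s \<in> ?J" and u: "periodic_flux T p u v (\<lambda>x. G s x (u x) - k)" and k: "k \<le> 0" for s u v k
  proof -
    obtain x0 where x0: "x0 \<in> {0..<T}" "\<And>x. x \<in> ?I \<Longrightarrow> u x - b2 x \<le> u x0 - b2 x0" "G s x0 (u x0) - k \<le> h2 x0"
      using periodic_comparison[OF T p u b2(1) gcont[OF s u] b2(2)] by metis
    have "u x0 \<le> b2 x0"
    proof (rule ccontr)
      assume gt: "\<not> u x0 \<le> b2 x0"
      have x0I: "x0 \<in> ?I" using x0 by auto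
      have cb: "c x0 (u x0) = b2 x0" using gt b2(3)[OF x0I] by (simp add: c_def)
      have "max 0 s * max 0 (a x0) \<le> 1 * max 0 (a x0)" using s by (intro mult_right_mono) auto
      then have "max (b2 x0) (max 0 s * max 0 (a x0)) = b2 x0" using a(5)[OF x0I] b2(3)[OF x0I] by auto
      moreover have "lam * m x0 * min 1 (1 + s) * f (b2 x0) \<le> lam * \<bar>m x0\<bar> * f (b2 x0)"
        using b2(3)[OF x0I] by (intro damped[OF s]) simp
      ultimately have "h2 x0 < G s x0 (u x0)" using b2(4)[OF x0I] gt by (simp add: G_def H_def cb)
      then show False using x0(3) k by simp
    qed
    then show ?thesis using x0(2) by force
  qed
  have Gin: "G s x y = H s x y" if "0 \<le> y" "y \<le> b2 x" for s x y using that by (simp add: G_def c_def)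
  have bounds: "\<forall>x\<in>?I. 0 \<le> u x \<and> u x \<le> b2 x \<and> G s x (u x) = H s x (u x)"
    if "s \<in> ?J" "periodic_flux T p u v (\<lambda>x. G s x (u x))" for s u v
    using lower[of s u v 0] upper[of s u v 0] that Gin by simp
  have b1_test: "\<exists>x0\<in>?I. (\<forall>x\<in>?I. u x - b1 x \<le> u x0 - b1 x0) \<and>
      q x0 * phi p (u x0) - lam * m x0 * min 1 (1 + s) * f (u x0) < q x0 * phi p (b1 x0) - lam * \<bar>m x0\<bar> * f (b1 x0)"
    if s: "s \<in> {-1..0}" and u: "periodic_flux T p u v (\<lambda>x. G s x (u x))" for s u v
  proof -
    have s': "s \<in> ?J" using s by auto
    have u': "periodic_flux T p u v (\<lambda>x. G s x (u x) - 0)" using u by simp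
    obtain x0 where x0: "x0 \<in> {0..<T}" "\<And>x. x \<in> ?I \<Longrightarrow> u x - b1 x \<le> u x0 - b1 x0" "G s x0 (u x0) - 0 \<le> h1 x0"
      using periodic_comparison[OF T p u' b1(1) gcont[OF s' u'] b1(2)] by metis
    have x0I: "x0 \<in> ?I" using x0 by auto
    have "G s x0 (u x0) = q x0 * phi p (u x0) - lam * m x0 * min 1 (1 + s) * f (u x0)"
      using bounds[OF s' u] x0I s by (simp add: H_def)
    then show ?thesis using x0 b1(4)[OF x0I] x0I by (intro bexI[of _ x0]) auto
  qed
  have a_test: "\<exists>x0\<in>?I. (\<forall>x\<in>?I. a x - u x \<le> a x0 - u x0) \<and> a x0 \<ge> 0 \<and> m x0 > 0 \<and> 0 \<le> u x0 \<and>
      q x0 * phi p (a x0) - lam * m x0 * f (a x0) < q x0 * phi p (u x0) - lam * m x0 * f (max (u x0) (s * a x0))"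
    if s: "s \<in> {0..1}" and u: "periodic_flux T p u v (\<lambda>x. G s x (u x))" and ge: "\<exists>x\<in>?I. u x \<le> a x" for s u v
  proof -
    have s': "s \<in> ?J" using s by auto
    have "continuous_on ?I (\<lambda>x. a x - u x)" by (intro continuous_intros ac periodic_flux_continuous[OF u])
    then obtain x0 where x0: "x0 \<in> ?I" "\<And>x. x \<in> ?I \<Longrightarrow> a x - u x \<le> a x0 - u x0"
      using continuous_attains_sup[of ?I "\<lambda>x. a x - u x"] T by auto
    have un: "u x0 \<ge> 0" using bounds[OF s' u] x0 by auto
    then have an: "a x0 \<ge> 0" using x0(2) ge by force
    have "ha x0 \<le> G s x0 (u x0)"
      using a(7)[OF x0(1) an] x0(2) gcont[OF s' u, of 0]
      by (intro bump_comparison[OF T p a(1-4) u]) auto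
    also have "\<dots> = q x0 * phi p (u x0) - lam * m x0 * f (max (u x0) (s * a x0))"
      using bounds[OF s' u] x0(1) s an by (simp add: H_def)
    finally show ?thesis using a(7)[OF x0(1) an] x0 un an by (intro bexI[of _ x0]) auto
  qed
  have C: "\<exists>u v. periodic_flux T p u v (\<lambda>x. G 1 x (u x))"
    "\<exists>u v. periodic_flux T p u v (\<lambda>x. G 0 x (u x)) \<and> (\<exists>x\<in>?I. b1 x < u x) \<and> (\<exists>x\<in>?I. u x < a x)"
    and plus1: "\<And>u v. periodic_flux T p u v (\<lambda>x. G 1 x (u x)) \<Longrightarrow> \<forall>x\<in>?I. a x \<le> u x"
  proof -
    have R1: "R + 1 > 0" using R0 by simp
    have barrier: "(k < 0 \<longrightarrow> u 0 < R + 1) \<and> (k > 0 \<longrightarrow> - (R + 1) < u 0)"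
      if "s \<in> ?J" "periodic_flux T p u v (\<lambda>x. G s x (u x) - k)" for s u v k
      using lower[OF that] upper[OF that] R[of 0] R0 T by force
    have strict1: "\<forall>x\<in>?I. u x < b1 x"
      if s: "s \<in> {-1..0}" and u: "periodic_flux T p u v (\<lambda>x. G s x (u x))" and le: "\<forall>x\<in>?I. u x \<le> b1 x" for s u v
    proof (rule ccontr)
      assume "\<not> ?thesis"
      then obtain x1 where x1: "x1 \<in> ?I" "u x1 = b1 x1" using le by force
      obtain x0 where x0: "x0 \<in> ?I" "\<forall>x\<in>?I. u x - b1 x \<le> u x0 - b1 x0"
        "q x0 * phi p (u x0) - lam * m x0 * min 1 (1 + s) * f (u x0) < q x0 * phi p (b1 x0) - lam * \<bar>m x0\<bar> * f (b1 x0)"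
        using b1_test[OF s u] by blast
      have eq: "u x0 = b1 x0" using x0 x1 le by force
      have "lam * m x0 * min 1 (1 + s) * f (b1 x0) \<le> lam * \<bar>m x0\<bar> * f (b1 x0)"
        using s b1(3)[OF x0(1)] by (intro damped) auto
      then show False using x0(3) eq by simp
    qed
    have strict2: "\<forall>x\<in>?I. a x < u x"
      if s: "s \<in> {0..1}" and u: "periodic_flux T p u v (\<lambda>x. G s x (u x))" and le: "\<forall>x\<in>?I. a x \<le> u x" for s u v
    proof (rule ccontr)
      assume "\<not> ?thesis"
      then have ex: "\<exists>x\<in>?I. u x \<le> a x" by force
      obtain x0 where x0: "x0 \<in> ?I" "\<forall>x\<in>?I. a x - u x \<le> a x0 - u x0" "a x0 \<ge> 0"
        "q x0 * phi p (a x0) - lam * m x0 * f (a x0) < q x0 * phi p (u x0) - lam * m x0 * f (max (u x0) (s * a x0))"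
        using a_test[OF s u ex] by blast
      have eq: "u x0 = a x0" using x0 ex le by force
      have "s * a x0 \<le> 1 * a x0" using s x0(3) by (intro mult_right_mono) auto
      then show False using x0(4) eq by simp
    qed
    \<comment> \<open>At \<open>s = -1\<close> only \<open>q x * phi p y\<close> is left, and its
      monotonicity in \<open>y\<close> forbids exceeding \<open>b1\<close>.\<close>
    have minus1: "\<forall>x\<in>?I. u x \<le> b1 x" if u: "periodic_flux T p u v (\<lambda>x. G (-1) x (u x))" for u v
    proof (rule ccontr)
      assume "\<not> ?thesis"
      then obtain x1 where x1: "x1 \<in> ?I" "u x1 > b1 x1" by force
      obtain x0 where x0: "x0 \<in> ?I" "\<forall>x\<in>?I. u x - b1 x \<le> u x0 - b1 x0"
        "q x0 * phi p (u x0) - lam * m x0 * min 1 (1 + -1) * f (u x0) < q x0 * phi p (b1 x0) - lam * \<bar>m x0\<bar> * f (b1 x0)"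
        using b1_test[OF _ u] by auto
      have gt: "u x0 > b1 x0" using x0(2) x1 by force
      have "q x0 * phi p (b1 x0) \<le> q x0 * phi p (u x0)"
        using gt q(2)[OF x0(1)] by (intro mult_left_mono) (auto simp: phi_le_iff p)
      moreover have "0 \<le> lam * \<bar>m x0\<bar> * f (b1 x0)" using lam b1(3)[OF x0(1)] by (intro mult_nonneg_nonneg fnn) auto
      ultimately show False using x0(3) by simp
    qed
    \<comment> \<open>Where \<open>u < a\<close>, both nonlinear terms are \<open>f (a x)\<close> at
      \<open>s = 1\<close>; they cancel, and monotonicity of the potential term decides.\<close>
    show plus1: "\<forall>x\<in>?I. a x \<le> u x" if u: "periodic_flux T p u v (\<lambda>x. G 1 x (u x))" for u v
    proof (rule ccontr)
      assume "\<not> ?thesis"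
      then obtain x1 where x1: "x1 \<in> ?I" "u x1 < a x1" by force
      then have ex: "\<exists>x\<in>?I. u x \<le> a x" by force
      have s: "(1::real) \<in> {0..1}" by simp
      obtain x0 where x0: "x0 \<in> ?I" "\<forall>x\<in>?I. a x - u x \<le> a x0 - u x0"
        "q x0 * phi p (a x0) - lam * m x0 * f (a x0) < q x0 * phi p (u x0) - lam * m x0 * f (max (u x0) (1 * a x0))"
        using a_test[OF s u ex] by blast
      have lt: "u x0 < a x0" using x0(2) x1 by force
      have "q x0 * phi p (u x0) \<le> q x0 * phi p (a x0)"
        using lt q(2)[OF x0(1)] by (intro mult_left_mono) (auto simp: phi_le_iff p)
      then show False using x0(3) lt by simp
    qed
    show "\<exists>u v. periodic_flux T p u v (\<lambda>x. G 1 x (u x))"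
      by (rule periodic_flux_continuation(1)[where G = G and R = "R + 1" and B = "B + 1" and ?b1.0 = b1 and ?b2.0 = a,
            OF T p R1 Gc])
         ((assumption | rule GB barrier b1c ac a(6) strict1 strict2 minus1 plus1)+)
    show "\<exists>u v. periodic_flux T p u v (\<lambda>x. G 0 x (u x)) \<and> (\<exists>x\<in>?I. b1 x < u x) \<and> (\<exists>x\<in>?I. u x < a x)"
      by (rule periodic_flux_continuation(2)[where G = G and R = "R + 1" and B = "B + 1" and ?b1.0 = b1 and ?b2.0 = a,
            OF T p R1 Gc])
         ((assumption | rule GB barrier b1c ac a(6) strict1 strict2 minus1 plus1)+)
  qed
  obtain u v where u: "periodic_flux T p u v (\<lambda>x. G 1 x (u x))" using C(1) by blast
  obtain u' v' where u': "periodic_flux T p u' v' (\<lambda>x. G 0 x (u' x))" "\<exists>x\<in>?I. b1 x < u' x" "\<exists>x\<in>?I. u' x < a x"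
    using C(2) by blast
  show ?thesis
  proof (rule that[of u v u' v'])
    show "\<forall>x\<in>?I. 0 \<le> u x" "\<forall>x\<in>?I. a x \<le> u x" using bounds[OF _ u] plus1[OF u] by auto
    show "\<forall>x\<in>?I. 0 \<le> u' x" using bounds[OF _ u'(1)] by auto
    show "periodic_flux T p u v (\<lambda>x. q x * phi p (u x) - lam * m x * f (u x))"
    proof (rule periodic_flux_cong[OF u])
      fix x assume "x \<in> {0<..<T}"
      then have x: "x \<in> ?I" by auto
      have "max (u x) (max 0 1 * max 0 (a x)) = u x" using bounds[OF _ u] plus1[OF u] x by auto
      then show "G 1 x (u x) = q x * phi p (u x) - lam * m x * f (u x)"
        using bounds[OF _ u] x by (simp add: H_def)
    qed
    show "periodic_flux T p u' v' (\<lambda>x. q x * phi p (u' x) - lam * m x * f (u' x))"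
      using bounds[OF _ u'(1)] by (intro periodic_flux_cong[OF u'(1)]) (auto simp: H_def)
  qed (use u' in auto)
qed

section \<open>Positive solutions\<close>

lemma growth_at_0:
  assumes p: "p > 1" and lim: "((\<lambda>s. f s / phi p s) \<longlongrightarrow> 0) (at 0)" and e: "e > 0"
  shows "\<exists>d>0. \<forall>s. 0 < \<bar>s\<bar> \<and> \<bar>s\<bar> < d \<longrightarrow> \<bar>f s\<bar> \<le> e * phi p \<bar>s\<bar>"
proof -
  obtain d where d: "d > 0" "\<And>s. \<lbrakk>s \<noteq> 0; dist s 0 < d\<rbrakk> \<Longrightarrow> dist (f s / phi p s) 0 < e"
    using tendstoD[OF lim e] unfolding eventually_at by auto
  have "\<bar>f s\<bar> \<le> e * phi p \<bar>s\<bar>" if "0 < \<bar>s\<bar>" "\<bar>s\<bar> < d" for s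
  proof -
    have "\<bar>f s\<bar> / phi p \<bar>s\<bar> < e" using d(2)[of s] that by (simp add: abs_phi dist_real_def)
    then show ?thesis using phi_pos[OF p that(1)] by (simp add: field_simps)
  qed
  then show ?thesis using d(1) by blast
qed

lemma growth_at_infinity:
  assumes p: "p > 1" and lim: "((\<lambda>s. f s / phi p s) \<longlongrightarrow> 0) at_infinity" and e: "e > 0"
  shows "\<exists>N>0. \<forall>s. \<bar>s\<bar> \<ge> N \<longrightarrow> \<bar>f s\<bar> \<le> e * phi p \<bar>s\<bar>"
proof -
  obtain N where N: "\<And>s. norm s \<ge> N \<Longrightarrow> dist (f s / phi p s) 0 < e"
    using tendstoD[OF lim e] unfolding eventually_at_infinity by auto
  have "\<bar>f s\<bar> \<le> e * phi p \<bar>s\<bar>" if "\<bar>s\<bar> \<ge> max 1 N" for s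
  proof -
    have "\<bar>f s\<bar> / phi p \<bar>s\<bar> < e" using N[of s] that by (simp add: abs_phi dist_real_def)
    moreover have "phi p \<bar>s\<bar> > 0" using that by (intro phi_pos p) auto
    ultimately show ?thesis by (simp add: field_simps)
  qed
  then show ?thesis by (intro exI[of _ "max 1 N"]) auto
qed

lemma strict_subsolution_exists:
  fixes T p :: real and q m f :: "real \<Rightarrow> real"
  assumes T: "T > 0" and p: "p > 1"
    and q: "continuous_on {0..T} q" and m: "continuous_on {0..T} m" "\<exists>x\<in>{0..T}. m x > 0"
    and f: "continuous_on UNIV f" "\<And>s. s > 0 \<Longrightarrow> f s > 0" "f 0 = 0"
  obtains a va ha L where
    "\<And>x. (a has_real_derivative va x) (at x)" "continuous_on UNIV va"
    "\<And>x. ((\<lambda>t. phi p (va t)) has_real_derivative ha x) (at x)" "continuous_on UNIV ha"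
    "\<And>x. a x \<le> 1" "\<exists>x\<in>{0..T}. a x > 0" "L > 0"
    "\<And>lam x. \<lbrakk>lam > L; x \<in> {0..T}; a x \<ge> 0\<rbrakk> \<Longrightarrow>
        x \<in> {0<..<T} \<and> m x > 0 \<and> q x * phi p (a x) - lam * m x * f (a x) < ha x"
proof -
  obtain x1 where x1: "x1 \<in> {0..T}" "m x1 > 0" using m(2) by blast
  then obtain d where d: "d > 0" "\<And>x. \<lbrakk>x \<in> {0..T}; dist x x1 < d\<rbrakk> \<Longrightarrow> dist (m x) (m x1) < m x1"
    using m(1) unfolding continuous_on_iff by blast
  define lo hi where "lo = max 0 (x1 - d)" and "hi = min T (x1 + d)"
  have lohi: "lo < hi" "0 \<le> lo" "hi \<le> T" using x1 d T by (auto simp: lo_def hi_def)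
  \<comment> \<open>A quarter of the length leaves a margin: the closed interval of radius
    \<open>r\<close> stays strictly between \<open>lo\<close> and \<open>hi\<close>.\<close>
  define c r where "c = (lo + hi) / 2" and "r = (hi - lo) / 4"
  have r: "r > 0" using lohi by (simp add: r_def)
  have mpos: "x \<in> {0<..<T} \<and> m x > 0" if "\<bar>x - c\<bar> \<le> r" for x
  proof -
    have "\<bar>x - (lo + hi) / 2\<bar> \<le> (hi - lo) / 4" using that by (simp add: c_def r_def)
    then have "lo < x" "x < hi" using lohi unfolding abs_le_iff by (simp_all add: field_simps)
    then have "x \<in> {0<..<T}" "dist x x1 < d" using lohi by (auto simp: lo_def hi_def dist_real_def)
    then show ?thesis using d(2)[of x] by (auto simp: dist_real_def abs_if split: if_splits)
  qed
  obtain a va ha where a: "\<And>x. (a has_real_derivative va x) (at x)" "continuous_on UNIV va"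
    "\<And>x. ((\<lambda>t. phi p (va t)) has_real_derivative ha x) (at x)" "continuous_on UNIV ha"
    "\<And>x. a x \<le> 1" "a c > 0" "\<And>x. a x \<ge> 0 \<Longrightarrow> \<bar>x - c\<bar> \<le> r" "\<And>x. a x = 0 \<Longrightarrow> ha x > 0"
    using bump_exists[OF p r, of c] by metis
  have ac: "continuous_on S a" for S using a(1) by (meson DERIV_continuous_on has_field_derivative_at_within)
  define D where "D x = q x * phi p (a x) - ha x" for x
  have Dc: "continuous_on {0..T} D"
    unfolding D_def using q by (intro continuous_intros p ac continuous_on_subset[OF a(4)]) auto
  define E where "E x = m x * f (a x)" for x
  have Ec: "continuous_on {0..T} E"
    unfolding E_def using m(1) by (intro continuous_intros continuous_on_compose2[OF f(1) ac]) auto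
  \<comment> \<open>Where \<open>a = 0\<close> the strict inequality holds for every \<open>lam\<close>, so \<open>f (a x)\<close> is bounded below on the
    compact set \<open>Z\<close> where largeness of \<open>lam\<close> is needed.\<close>
  define Z where "Z = {x \<in> {0..T}. 0 \<le> a x} \<inter> {x \<in> {0..T}. 0 \<le> D x}"
  have "closed Z" unfolding Z_def by (intro closed_Int continuous_on_closed_Collect_le closed_atLeastAtMost ac Dc continuous_on_const)
  moreover have "Z \<subseteq> {0..T}" by (auto simp: Z_def)
  ultimately have Z: "compact Z" "Z \<subseteq> {0..T}"
    using compact_Int_closed[of "{0..T}" Z] by (simp_all add: Int_absorb1)
  have Epos: "E x > 0" if "x \<in> Z" for x
  proof -
    have "a x \<noteq> 0" using that a(8)[of x] by (auto simp: Z_def D_def)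
    then show ?thesis using that mpos[OF a(7)] f(2) by (auto simp: Z_def E_def)
  qed
  obtain L where L: "L > 0" "\<And>x. x \<in> Z \<Longrightarrow> D x < L * E x"
  proof (cases "Z = {}")
    case True
    then show ?thesis using that[of 1] by simp
  next
    case False
    have "continuous_on Z (\<lambda>x. D x / E x)"
      using Epos by (intro continuous_on_divide continuous_on_subset[OF Dc Z(2)] continuous_on_subset[OF Ec Z(2)]) force
    then obtain z where z: "z \<in> Z" "\<And>x. x \<in> Z \<Longrightarrow> D x / E x \<le> D z / E z"
      using continuous_attains_sup[OF Z(1) False] by blast
    have "D z / E z \<ge> 0" using z(1) Epos[OF z(1)] by (simp add: Z_def)
    moreover have "D x < (D z / E z + 1) * E x" if "x \<in> Z" for x
    proof -
      have "D x / E x < D z / E z + 1" using z(2)[OF that] by simp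
      then show ?thesis using Epos[OF that] by (simp only: pos_divide_less_eq)
    qed
    ultimately show ?thesis by (intro that[of "D z / E z + 1"]) auto
  qed
  show ?thesis
  proof (rule that[of a va ha L])
    have "\<bar>c - c\<bar> \<le> r" using r by simp
    then have "c \<in> {0<..<T}" using mpos by blast
    then have "c \<in> {0..T}" by simp
    then show "\<exists>x\<in>{0..T}. a x > 0" using a(6) by blast
    fix lam x assume lam: "lam > L" and x: "x \<in> {0..T}" "a x \<ge> 0"
    have mx: "x \<in> {0<..<T} \<and> m x > 0" using mpos[OF a(7)[OF x(2)]] .
    have "D x < lam * E x"
    proof (cases "x \<in> Z")
      case True
      have "L * E x \<le> lam * E x" using lam Epos[OF True] by (intro mult_right_mono) auto
      then show ?thesis using L(2)[OF True] by simp
    next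
      case False
      have "f (a x) \<ge> 0" using x(2) f(2)[of "a x"] f(3) by (cases "a x = 0") auto
      then have "lam * E x \<ge> 0" unfolding E_def using mx lam L(1) by (intro mult_nonneg_nonneg) auto
      then show ?thesis using False x by (auto simp: Z_def)
    qed
    then show "x \<in> {0<..<T} \<and> m x > 0 \<and> q x * phi p (a x) - lam * m x * f (a x) < ha x"
      using mx by (auto simp: D_def E_def mult.assoc)
  qed (use a L in auto)
qed

text \<open>The constant 1 works near 0 and near infinity, and the compact middle range only
  enlarges it. The global bound feeds the strong maximum principle and the nonexistence
  threshold.\<close>

lemma nonlinearity_le_phi:
  assumes p: "p > 1" and f: "continuous_on UNIV f" "f 0 = 0"
    and d: "d > 0" "\<And>s. \<lbrakk>0 < s; s < d\<rbrakk> \<Longrightarrow> f s \<le> phi p s"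
    and N: "\<And>s. s \<ge> N \<Longrightarrow> f s \<le> phi p s"
  obtains C where "C > 0" "\<And>s. s \<ge> 0 \<Longrightarrow> f s \<le> C * phi p s"
proof -
  have "bounded (f ` {d..N})"
    by (intro compact_imp_bounded compact_continuous_image continuous_on_subset[OF f(1)]) auto
  then obtain M where "\<forall>y\<in>f ` {d..N}. norm y \<le> M" unfolding bounded_iff by blast
  then have M: "f s \<le> \<bar>M\<bar>" if "s \<in> {d..N}" for s using that by force
  have pd: "phi p d > 0" using p d(1) by (rule phi_pos)
  define C where "C = 1 + \<bar>M\<bar> / phi p d"
  have C: "C \<ge> 1" using pd by (simp add: C_def)
  have "f s \<le> C * phi p s" if s: "s \<ge> 0" for s
  proof -
    have ps: "phi p s \<ge> 0" using p s by (rule phi_nonneg)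
    then have le: "phi p s \<le> C * phi p s" using C by (simp add: mult_le_cancel_right1)
    consider "s = 0" | "0 < s" "s < d" | "s \<in> {d..N}" | "s \<ge> N" using s by fastforce
    then show ?thesis
    proof cases
      case 3
      then have "phi p d \<le> phi p s" using p by (simp add: phi_le_iff)
      then have "\<bar>M\<bar> \<le> \<bar>M\<bar> / phi p d * phi p s"
        using pd by (simp add: field_simps mult_left_mono)
      then show ?thesis using M[OF 3] ps by (simp add: C_def distrib_right)
    qed (use f(2) d N le in \<open>auto intro: order.trans\<close>)
  qed
  then show ?thesis using C by (intro that[of C]) auto
qed

theorem two_positive_solutions:
  fixes T p :: real and q m f :: "real \<Rightarrow> real"
  assumes T: "T > 0" and p: "p > 1"
    and q: "continuous_on {0..T} q" "\<And>x. x \<in> {0..T} \<Longrightarrow> q x \<ge> 0" "\<exists>x\<in>{0..T}. q x \<noteq> 0"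
    and m: "continuous_on {0..T} m" "\<exists>x\<in>{0..T}. m x > 0"
    and f: "continuous_on UNIV f" "\<And>s. s > 0 \<Longrightarrow> f s > 0" "f 0 = 0"
    and small: "\<And>e. e > 0 \<Longrightarrow> \<exists>d>0. \<forall>s. 0 < s \<and> s < d \<longrightarrow> f s \<le> e * phi p s"
    and large: "\<And>e. e > 0 \<Longrightarrow> \<exists>N>0. \<forall>s\<ge>N. f s \<le> e * phi p s"
  shows "\<exists>L>0. \<forall>lam>L. \<exists>u1 u2. positive_solution T p q m f lam u1 \<and> positive_solution T p q m f lam u2 \<and>
      (\<exists>x\<in>{0..T}. u1 x \<noteq> u2 x)"
proof -
  let ?I = "{0..T}"
  obtain a va ha L where a: "\<And>x. (a has_real_derivative va x) (at x)" "continuous_on UNIV va"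
    "\<And>x. ((\<lambda>t. phi p (va t)) has_real_derivative ha x) (at x)" "continuous_on UNIV ha"
    and a1: "\<And>x. a x \<le> 1" and apos: "\<exists>x\<in>?I. a x > 0" and L: "L > 0"
    and sub: "\<And>lam x. \<lbrakk>lam > L; x \<in> ?I; a x \<ge> 0\<rbrakk> \<Longrightarrow>
        x \<in> {0<..<T} \<and> m x > 0 \<and> q x * phi p (a x) - lam * m x * f (a x) < ha x"
    using strict_subsolution_exists[OF T p q(1) m f] by metis
  obtain e v h k where k: "k > 0" and e: "periodic_flux T p e v h" "continuous_on ?I h"
    and eb: "\<And>x. x \<in> ?I \<Longrightarrow> 1/2 \<le> e x \<and> e x \<le> 3/2 \<and> h x \<le> q x * phi p (e x) - k"
    using supersolution_exists[OF T p q] by metis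
  have "bounded (m ` ?I)" by (intro compact_imp_bounded compact_continuous_image m) auto
  then obtain M0 where M0: "\<forall>y\<in>m ` ?I. norm y \<le> M0" unfolding bounded_iff by blast
  define M where "M = \<bar>M0\<bar> + 1"
  have M: "M > 0" "\<And>x. x \<in> ?I \<Longrightarrow> \<bar>m x\<bar> \<le> M" using M0 by (force simp: M_def)+
  obtain x2 where x2: "x2 \<in> ?I" "a x2 > 0" using apos by blast
  obtain d1 where d1: "d1 > 0" "\<And>s. 0 < s \<and> s < d1 \<Longrightarrow> f s \<le> 1 * phi p s" using small[of 1] by auto
  obtain N1 where N1: "\<And>s. s \<ge> N1 \<Longrightarrow> f s \<le> 1 * phi p s" using large[of 1] by auto
  obtain C where C: "C > 0" "\<And>s. s \<ge> 0 \<Longrightarrow> f s \<le> C * phi p s"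
    using nonlinearity_le_phi[OF p f(1,3) d1(1), of N1] d1(2) N1 by auto
  have "\<exists>u1 u2. positive_solution T p q m f lam u1 \<and> positive_solution T p q m f lam u2 \<and>
      (\<exists>x\<in>?I. u1 x \<noteq> u2 x)" if lam: "lam > L" for lam
  proof -
    have lam0: "lam > 0" using lam L by simp
    \<comment> \<open>With \<open>f \<le> \<epsilon> * phi p\<close> and
      \<open>e x \<le> 3/2\<close>, the nonlinearity costs at most \<open>phi p s * (k / 2)\<close>,
      half of the gain \<open>phi p s * k\<close> of the multiple \<open>s e\<close>.\<close>
    define \<epsilon> where "\<epsilon> = k / (2 * lam * M * phi p (3/2))"
    have p32: "phi p (3/2) > 0" using p by (intro phi_pos) auto
    have \<epsilon>: "\<epsilon> > 0" "lam * M * (\<epsilon> * phi p (3/2)) = k / 2"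
      using k lam0 M(1) p32 by (auto simp: \<epsilon>_def field_simps)
    have scaled: "periodic_flux T p (\<lambda>x. s * e x) (\<lambda>x. s * v x) (\<lambda>x. phi p s * h x)"
        "continuous_on ?I (\<lambda>x. phi p s * h x)" for s
      using e by (auto intro: periodic_flux_scale continuous_intros)
    have super: "phi p s * h x < q x * phi p (s * e x) - lam * \<bar>m x\<bar> * f (s * e x)"
      if s: "s > 0" and x: "x \<in> ?I" and fs: "f (s * e x) \<le> \<epsilon> * phi p (s * e x)" for s x
    proof -
      have ps: "phi p s > 0" using p s by (rule phi_pos)
      have "phi p (e x) \<le> phi p (3/2)" using eb[OF x] p by (simp add: phi_le_iff)
      then have "phi p (s * e x) \<le> phi p s * phi p (3/2)" using ps by (simp add: phi_mult mult_left_mono)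
      then have "\<epsilon> * phi p (s * e x) \<le> \<epsilon> * (phi p s * phi p (3/2))" using \<epsilon> by (intro mult_left_mono) auto
      then have f1: "f (s * e x) \<le> \<epsilon> * (phi p s * phi p (3/2))" using fs by simp
      have "s * e x > 0" using s eb[OF x] by (intro mult_pos_pos) auto
      then have "f (s * e x) > 0" by (rule f(2))
      then have "lam * \<bar>m x\<bar> * f (s * e x) \<le> lam * M * (\<epsilon> * (phi p s * phi p (3/2)))"
        using f1 lam0 M(2)[OF x] M(1) by (intro mult_mono mult_left_mono) auto
      also have "\<dots> = phi p s * (lam * M * (\<epsilon> * phi p (3/2)))" by (simp only: ac_simps)
      also have "\<dots> = phi p s * (k / 2)" by (simp only: \<epsilon>)
      also have "\<dots> < phi p s * k" using ps k by simp
      finally have *: "lam * \<bar>m x\<bar> * f (s * e x) < phi p s * k" .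
      have "phi p s * h x \<le> phi p s * (q x * phi p (e x) - k)" using eb[OF x] ps by (intro mult_left_mono) auto
      also have "\<dots> = q x * phi p (s * e x) - phi p s * k" by (simp add: phi_mult algebra_simps)
      finally show ?thesis using * by simp
    qed
    obtain d where d: "d > 0" "\<And>s. 0 < s \<and> s < d \<Longrightarrow> f s \<le> \<epsilon> * phi p s" using small[OF \<epsilon>(1)] by blast
    obtain N where N: "N > 0" "\<And>s. s \<ge> N \<Longrightarrow> f s \<le> \<epsilon> * phi p s" using large[OF \<epsilon>(1)] by blast
    \<comment> \<open>The range of \<open>e\<close> between 1/2 and 3/2 enters here:
      \<open>s1 * e\<close> stays below \<open>d\<close>, and below the bump at \<open>x2\<close>;
      \<open>s2 * e\<close> stays above \<open>N\<close>, and above 1, hence above the bump.\<close>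
    define s1 where "s1 = min d (a x2) / 2"
    define s2 where "s2 = 2 * max N 1"
    have s1: "s1 > 0" "s1 * (3/2) < d" "s1 * (3/2) < a x2" using d x2 by (auto simp: s1_def min_def)
    have s2: "s2 > 0" "s2 * (1/2) \<ge> N" "s2 * (1/2) \<ge> 1" using N by (auto simp: s2_def)
    have e1: "0 < s1 * e x" "s1 * e x \<le> s1 * (3/2)" if "x \<in> ?I" for x
      using eb[OF that] s1 by (auto intro!: mult_pos_pos mult_left_mono)
    have e2: "s2 * (1/2) \<le> s2 * e x" if "x \<in> ?I" for x
      using eb[OF that] s2(1) by (intro mult_left_mono) auto
    obtain u w u' w' where
      u: "periodic_flux T p u w (\<lambda>x. q x * phi p (u x) - lam * m x * f (u x))"
        "\<forall>x\<in>?I. 0 \<le> u x" "\<forall>x\<in>?I. a x \<le> u x" and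
      u': "periodic_flux T p u' w' (\<lambda>x. q x * phi p (u' x) - lam * m x * f (u' x))"
        "\<forall>x\<in>?I. 0 \<le> u' x" "\<exists>x\<in>?I. s1 * e x < u' x" "\<exists>x\<in>?I. u' x < a x"
    proof (rule two_solutions_between_barriers[OF T p q(1,2) m(1) f(1,3,2) lam0 scaled(1)[of s1] scaled(2)[of s1] _ _
          scaled(1)[of s2] scaled(2)[of s2] _ _ a])
      fix x assume x: "x \<in> ?I"
      show "0 < s1 * e x" using e1[OF x] by simp
      show "0 < s2 * e x" using e2[OF x] s2 by linarith
      show "phi p s1 * h x < q x * phi p (s1 * e x) - lam * \<bar>m x\<bar> * f (s1 * e x)"
        by (rule super[OF s1(1) x], rule d(2), intro conjI) (use e1[OF x] s1 in linarith)+
      show "phi p s2 * h x < q x * phi p (s2 * e x) - lam * \<bar>m x\<bar> * f (s2 * e x)"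
        by (rule super[OF s2(1) x], rule N(2)) (use e2[OF x] s2 in linarith)
      show "a x \<le> s2 * e x" using a1[of x] e2[OF x] s2 by linarith
    next
      have "s1 * e x2 < a x2" using e1[OF x2(1)] s1 by linarith
      then show "\<exists>x\<in>?I. s1 * e x < a x" using x2 by blast
    qed (use sub[OF lam] in auto)
    have "bounded (q ` ?I)" by (intro compact_imp_bounded compact_continuous_image q) auto
    then obtain Q where "\<forall>y\<in>q ` ?I. norm y \<le> Q" unfolding bounded_iff by blast
    then have Q: "\<bar>q x\<bar> \<le> Q" if "x \<in> ?I" for x using that by auto
    have Q0: "Q \<ge> 0" using Q[of 0] T by auto
    \<comment> \<open>The strong maximum principle needs a right-hand side dominated by a multiple
      of \<open>phi p u\<close>; boundedness of \<open>q\<close> and \<open>m\<close> and the global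
      bound \<open>C\<close> provide it.\<close>
    define K where "K = Q + lam * M * C"
    have K: "K > 0" using Q0 lam0 M(1) C(1) by (simp add: K_def add_nonneg_pos)
    have gbound: "\<bar>q x * phi p y - lam * m x * f y\<bar> \<le> K * phi p y" if x: "x \<in> ?I" and y: "y \<ge> 0" for x y
    proof -
      have py: "phi p y \<ge> 0" using p y by (rule phi_nonneg)
      have fy: "f y \<ge> 0" using f(2)[of y] f(3) y by (cases "y = 0") auto
      have "\<bar>q x * phi p y\<bar> \<le> Q * phi p y" using Q[OF x] py by (simp add: abs_mult mult_right_mono)
      moreover have "\<bar>lam * m x * f y\<bar> \<le> lam * M * (C * phi p y)"
        using M(2)[OF x] M(1) C(2)[OF y] fy lam0 by (simp add: abs_mult) (intro mult_mono mult_left_mono; auto)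
      ultimately show ?thesis by (simp add: K_def algebra_simps)
    qed
    have positive: "positive_solution T p q m f lam z"
      if z: "periodic_flux T p z y (\<lambda>x. q x * phi p (z x) - lam * m x * f (z x))"
        "\<forall>x\<in>?I. 0 \<le> z x" "\<exists>x\<in>?I. z x > 0" for z y
      unfolding positive_solution_def periodic_solution_iff_flux
      using z nonneg_solution_positive[OF T p z(1) _ _ K z(3)] gbound by blast
    have "\<exists>x\<in>?I. u x > 0" using u(3) x2 by force
    moreover have "\<exists>x\<in>?I. u' x > 0" using u'(3) e1 by force
    moreover have "\<exists>x\<in>?I. u x \<noteq> u' x" using u(3) u'(4) by force
    ultimately show ?thesis using positive[OF u(1,2)] positive[OF u'(1,2)] by blast
  qed
  then show ?thesis using L by blast
qed

theorem no_positive_solution: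
  fixes T p :: real and q m f :: "real \<Rightarrow> real"
  assumes T: "T > 0" and p: "p > 1"
    and q: "continuous_on {0..T} q" "\<And>x. x \<in> {0..T} \<Longrightarrow> q x \<ge> 0" "\<exists>x\<in>{0..T}. q x \<noteq> 0"
    and m: "continuous_on {0..T} m"
    and f: "continuous_on UNIV f" "\<And>s. s > 0 \<Longrightarrow> f s > 0" "f 0 = 0"
    and small: "\<And>e. e > 0 \<Longrightarrow> \<exists>d>0. \<forall>s. 0 < s \<and> s < d \<longrightarrow> f s \<le> e * phi p s"
    and large: "\<And>e. e > 0 \<Longrightarrow> \<exists>N>0. \<forall>s\<ge>N. f s \<le> e * phi p s"
  shows "\<exists>\<mu>>0. \<forall>lam\<in>{0<..<\<mu>}. \<not> (\<exists>u. positive_solution T p q m f lam u)"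
proof -
  let ?I = "{0..T}"
  obtain e v h k where k: "k > 0" and e: "periodic_flux T p e v h" "continuous_on ?I h"
    and eb: "\<And>x. x \<in> ?I \<Longrightarrow> 1/2 \<le> e x \<and> e x \<le> 3/2 \<and> h x \<le> q x * phi p (e x) - k"
    using supersolution_exists[OF T p q] by metis
  have "bounded (m ` ?I)" by (intro compact_imp_bounded compact_continuous_image m) auto
  then obtain M0 where M0: "\<forall>y\<in>m ` ?I. norm y \<le> M0" unfolding bounded_iff by blast
  define M where "M = \<bar>M0\<bar> + 1"
  have M: "M > 0" "\<And>x. x \<in> ?I \<Longrightarrow> \<bar>m x\<bar> \<le> M" using M0 by (force simp: M_def)+
  obtain d1 where d1: "d1 > 0" "\<And>s. 0 < s \<and> s < d1 \<Longrightarrow> f s \<le> 1 * phi p s" using small[of 1] by auto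
  obtain N1 where N1: "\<And>s. s \<ge> N1 \<Longrightarrow> f s \<le> 1 * phi p s" using large[of 1] by auto
  obtain C where C: "C > 0" "\<And>s. s \<ge> 0 \<Longrightarrow> f s \<le> C * phi p s"
    using nonlinearity_le_phi[OF p f(1,3) d1(1), of N1] d1(2) N1 by auto
  have p32: "phi p (3/2) > 0" using p by (intro phi_pos) auto
  \<comment> \<open>At a touching point the gain \<open>phi p s * k\<close> is at most
    \<open>lam * M * C * phi p s * phi p (3/2)\<close>. The factor \<open>phi p s\<close> cancels,
    so the threshold does not depend on the solution.\<close>
  define \<mu> where "\<mu> = k / (M * C * phi p (3/2))"
  have \<mu>: "\<mu> > 0" using k M(1) C(1) p32 by (simp add: \<mu>_def)
  have False if lam: "0 < lam" "lam < \<mu>" and u: "positive_solution T p q m f lam u" for lam u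
  proof -
    obtain w where w: "periodic_flux T p u w (\<lambda>x. q x * phi p (u x) - lam * m x * f (u x))" and up: "\<And>x. x \<in> ?I \<Longrightarrow> u x > 0"
      using u unfolding positive_solution_def periodic_solution_iff_flux by blast
    have uc: "continuous_on ?I u" and ec: "continuous_on ?I e" using w e by (auto intro: periodic_flux_continuous)
    have epos: "e x > 0" if "x \<in> ?I" for x using eb[OF that] by linarith
    have "continuous_on ?I (\<lambda>x. u x / e x)" using epos by (intro continuous_on_divide uc ec) force
    then obtain x1 where x1: "x1 \<in> ?I" "\<And>x. x \<in> ?I \<Longrightarrow> u x / e x \<le> u x1 / e x1"
      using continuous_attains_sup[of ?I "\<lambda>x. u x / e x"] T by auto
    \<comment> \<open>The least multiple of \<open>e\<close> lying above \<open>u\<close>.\<close>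
    define s where "s = u x1 / e x1"
    have s: "s > 0" using up x1 epos by (simp add: s_def)
    have le: "u x \<le> s * e x" if "x \<in> ?I" for x using x1(2)[OF that] epos[OF that] by (simp add: s_def pos_divide_le_eq)
    have eq: "u x1 = s * e x1" using epos[OF x1(1)] by (simp add: s_def)
    have gc: "continuous_on ?I (\<lambda>x. q x * phi p (u x) - lam * m x * f (u x))"
      using q(1) m uc by (intro continuous_intros p continuous_on_compose2[OF f(1)]) auto
    have hc: "continuous_on ?I (\<lambda>x. phi p s * h x)" using e(2) by (intro continuous_intros)
    obtain x0 where x0: "x0 \<in> {0..<T}" "\<And>x. x \<in> ?I \<Longrightarrow> u x - s * e x \<le> u x0 - s * e x0"
      "q x0 * phi p (u x0) - lam * m x0 * f (u x0) \<le> phi p s * h x0"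
      using periodic_comparison[OF T p w periodic_flux_scale[OF e(1), of s] gc hc] by metis
    have x0I: "x0 \<in> ?I" using x0(1) by auto
    \<comment> \<open>The comparison point may differ from \<open>x1\<close>, but the maximum of
      \<open>u - s * e\<close> is 0, so it is a touching point as well.\<close>
    have touch: "u x0 = s * e x0" using x0(2)[OF x1(1)] eq le[OF x0I] by simp
    have ps: "phi p s > 0" using p s by (rule phi_pos)
    have "phi p s * h x0 \<le> phi p s * (q x0 * phi p (e x0) - k)" using eb[OF x0I] ps by (intro mult_left_mono) auto
    also have "\<dots> = q x0 * phi p (u x0) - phi p s * k" by (simp add: touch phi_mult algebra_simps)
    finally have "phi p s * k \<le> lam * m x0 * f (u x0)" using x0(3) by simp
    also have "\<dots> \<le> lam * M * f (u x0)"
      using lam M(2)[OF x0I] f(2)[OF up[OF x0I]] by (intro mult_right_mono mult_left_mono) auto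
    also have "\<dots> \<le> lam * M * (C * (phi p s * phi p (3/2)))"
    proof (intro mult_left_mono)
      have "phi p (e x0) \<le> phi p (3/2)" using eb[OF x0I] p by (simp add: phi_le_iff)
      then have "phi p (u x0) \<le> phi p s * phi p (3/2)" using ps by (simp add: touch phi_mult mult_left_mono)
      then have "C * phi p (u x0) \<le> C * (phi p s * phi p (3/2))" using C(1) by (intro mult_left_mono) auto
      then show "f (u x0) \<le> C * (phi p s * phi p (3/2))" using C(2)[of "u x0"] up[OF x0I] by simp
    qed (use lam M in auto)
    also have "\<dots> = phi p s * (lam * (M * C * phi p (3/2)))" by (simp only: ac_simps)
    finally have "k \<le> lam * (M * C * phi p (3/2))" using ps by simp
    also have "\<dots> < \<mu> * (M * C * phi p (3/2))" using lam M(1) C(1) p32 by (intro mult_strict_right_mono) auto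
    also have "\<dots> = k" using M(1) C(1) p32 by (simp add: \<mu>_def)
    finally show False by simp
  qed
  then show ?thesis using \<mu> by (intro exI[of _ \<mu>]) auto
qed

section \<open>Reduction to positive solutions by reflection\<close>

lemma positive_solution_uminus_weight:
  "positive_solution T p q (\<lambda>x. - m x) f (- lam) u \<longleftrightarrow> positive_solution T p q m f lam u"
  unfolding positive_solution_def periodic_solution_def by simp

lemma negative_solution_reflect:
  "negative_solution T p q m f lam u \<longleftrightarrow> positive_solution T p q m (\<lambda>s. - f (- s)) lam (\<lambda>x. - u x)"
proof -
  have reflect: "periodic_flux T p (\<lambda>x. - z x) (\<lambda>x. - y x) (\<lambda>x. - g x)" if "periodic_flux T p z y g" for z y g
    using periodic_flux_scale[OF that, of "-1"] by simp
  have "periodic_solution T p q m g lam (\<lambda>x. - z x)"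
    if "periodic_solution T p q m f lam z" "\<And>s. g s = - f (- s)" for f g z
    using that reflect unfolding periodic_solution_iff_flux by fastforce
  note * = this
  have "periodic_solution T p q m f lam u \<longleftrightarrow> periodic_solution T p q m (\<lambda>s. - f (- s)) lam (\<lambda>x. - u x)"
  proof
    assume "periodic_solution T p q m f lam u"
    then show "periodic_solution T p q m (\<lambda>s. - f (- s)) lam (\<lambda>x. - u x)" by (rule *) simp
  next
    assume "periodic_solution T p q m (\<lambda>s. - f (- s)) lam (\<lambda>x. - u x)"
    then have "periodic_solution T p q m f lam (\<lambda>x. - (- u x))" by (rule *) simp
    then show "periodic_solution T p q m f lam u" by simp
  qed
  then show ?thesis unfolding positive_solution_def negative_solution_def by simp
qed

theorem theorem5p8:
  fixes T p :: real and q m f :: "real \<Rightarrow> real"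
  assumes "T > 0" and "p > 1"
    and "continuous_on {0..T} q" and "\<forall>x\<in>{0..T}. q x \<ge> 0" and "\<exists>x\<in>{0..T}. q x \<noteq> 0"
    and "continuous_on {0..T} m" and "\<exists>x\<in>{0..T}. m x > 0" and "\<exists>x\<in>{0..T}. m x < 0"
    and "continuous_on UNIV f" and "\<forall>s. s \<noteq> 0 \<longrightarrow> f s * s > 0"
    and f_0: "((\<lambda>s. f s / phi p s) \<longlongrightarrow> 0) (at 0)"
    and f_infinity: "((\<lambda>s. f s / phi p s) \<longlongrightarrow> 0) at_infinity"
  shows "(\<exists>lp>0. \<exists>lm<0. \<forall>lam\<in>{lp<..} \<union> {..<lm}.
            \<exists>u1 u2. positive_solution T p q m f lam u1 \<and> positive_solution T p q m f lam u2 \<and>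
              (\<exists>x\<in>{0..T}. u1 x \<noteq> u2 x))
       \<and> (\<exists>lp>0. \<exists>lm<0. \<forall>lam\<in>{lp<..} \<union> {..<lm}.
            \<exists>u1 u2. negative_solution T p q m f lam u1 \<and> negative_solution T p q m f lam u2 \<and>
              (\<exists>x\<in>{0..T}. u1 x \<noteq> u2 x))
       \<and> (\<forall>\<nu>\<in>{1, -1 :: real}. \<exists>\<mu>>0. \<forall>lam\<in>{0<..<\<mu>}.
            \<not> (\<exists>u. one_sign_solution T p q m f lam u))"
proof -
  let ?I = "{0..T}"
  define f' where "f' s = - f (- s)" for s
  have f_pos: "f s > 0" if "s > 0" for s
    using assms(10)[rule_format, of s] that by (simp add: zero_less_mult_iff)
  have f'_pos: "f' s > 0" if "s > 0" for s
    using assms(10)[rule_format, of "- s"] that by (auto simp: f'_def mult_less_0_iff)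
  \<comment> \<open>The sign hypothesis is silent at 0, but \<open>f 0\<close> is a limit of
    positive values from the right and of negative values from the left.\<close>
  have "isCont f s" for s using assms(9) by (simp add: continuous_on_eq_continuous_at)
  then have "(f \<longlongrightarrow> f 0) (at_right 0)" "(f \<longlongrightarrow> f 0) (at_left 0)"
    by (simp_all add: isCont_def filterlim_at_split)
  moreover have "\<forall>\<^sub>F s in at_right (0::real). 0 \<le> f s" "\<forall>\<^sub>F s in at_left (0::real). f s \<le> 0"
    using f_pos f'_pos[of "- s" for s]
    by (auto simp: eventually_at_filter f'_def less_imp_le intro!: always_eventually)
  ultimately have "0 \<le> f 0" "f 0 \<le> 0"
    by (auto intro: tendsto_lowerbound tendsto_upperbound)
  then have f0: "f 0 = 0" "f' 0 = 0" by (auto simp: f'_def)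
  have f'c: "continuous_on UNIV f'"
    unfolding f'_def by (intro continuous_intros continuous_on_compose2[OF assms(9)]) auto
  have small: "\<exists>d>0. \<forall>s. 0 < s \<and> s < d \<longrightarrow> f s \<le> e * phi p s" "\<exists>d>0. \<forall>s. 0 < s \<and> s < d \<longrightarrow> f' s \<le> e * phi p s"
    if e: "e > 0" for e
  proof -
    obtain d where d: "d > 0" "\<And>s. 0 < \<bar>s\<bar> \<and> \<bar>s\<bar> < d \<Longrightarrow> \<bar>f s\<bar> \<le> e * phi p \<bar>s\<bar>"
      using growth_at_0[OF assms(2) f_0 e] by blast
    have "f s \<le> e * phi p s \<and> f' s \<le> e * phi p s" if "0 < s \<and> s < d" for s
      using d(2)[of s] d(2)[of "- s"] that by (auto simp: f'_def abs_le_iff)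
    then show "\<exists>d>0. \<forall>s. 0 < s \<and> s < d \<longrightarrow> f s \<le> e * phi p s" "\<exists>d>0. \<forall>s. 0 < s \<and> s < d \<longrightarrow> f' s \<le> e * phi p s"
      using d(1) by blast+
  qed
  have large: "\<exists>N>0. \<forall>s\<ge>N. f s \<le> e * phi p s" "\<exists>N>0. \<forall>s\<ge>N. f' s \<le> e * phi p s" if e: "e > 0" for e
  proof -
    obtain N where N: "N > 0" "\<And>s. \<bar>s\<bar> \<ge> N \<Longrightarrow> \<bar>f s\<bar> \<le> e * phi p \<bar>s\<bar>"
      using growth_at_infinity[OF assms(2) f_infinity e] by blast
    have "f s \<le> e * phi p s \<and> f' s \<le> e * phi p s" if "s \<ge> N" for s
      using N(1) N(2)[of s] N(2)[of "- s"] that by (auto simp: f'_def abs_le_iff)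
    then show "\<exists>N>0. \<forall>s\<ge>N. f s \<le> e * phi p s" "\<exists>N>0. \<forall>s\<ge>N. f' s \<le> e * phi p s"
      using N(1) by blast+
  qed
  have q: "\<And>x. x \<in> ?I \<Longrightarrow> q x \<ge> 0" using assms(4) by blast
  have m': "continuous_on ?I (\<lambda>x. - m x)" "\<exists>x\<in>?I. - m x > 0"
    using assms(6,8) by (auto intro: continuous_intros)
  \<comment> \<open>Negative \<open>lam\<close> with weight \<open>m\<close> is positive
    \<open>- lam\<close> with weight \<open>- m\<close>; both weights are positive somewhere because
    \<open>m\<close> changes sign.\<close>
  have both_signs: "\<exists>lp>0. \<exists>lm<0. \<forall>lam\<in>{lp<..} \<union> {..<lm}.
      \<exists>u1 u2. positive_solution T p q m g lam u1 \<and> positive_solution T p q m g lam u2 \<and> (\<exists>x\<in>?I. u1 x \<noteq> u2 x)"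
    if g: "continuous_on UNIV g" "\<And>s. s > 0 \<Longrightarrow> g s > 0" "g 0 = 0"
      "\<And>e. e > 0 \<Longrightarrow> \<exists>d>0. \<forall>s. 0 < s \<and> s < d \<longrightarrow> g s \<le> e * phi p s"
      "\<And>e. e > 0 \<Longrightarrow> \<exists>N>0. \<forall>s\<ge>N. g s \<le> e * phi p s" for g
  proof -
    obtain L where L: "L > 0" "\<And>lam. lam > L \<Longrightarrow> \<exists>u1 u2. positive_solution T p q m g lam u1 \<and>
        positive_solution T p q m g lam u2 \<and> (\<exists>x\<in>?I. u1 x \<noteq> u2 x)"
      using two_positive_solutions[OF assms(1-3) q assms(5-7) g] by blast
    obtain L' where L': "L' > 0" "\<And>lam. lam > L' \<Longrightarrow> \<exists>u1 u2. positive_solution T p q (\<lambda>x. - m x) g lam u1 \<and>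
        positive_solution T p q (\<lambda>x. - m x) g lam u2 \<and> (\<exists>x\<in>?I. u1 x \<noteq> u2 x)"
      using two_positive_solutions[OF assms(1-3) q assms(5) m' g] by blast
    have "\<exists>u1 u2. positive_solution T p q m g lam u1 \<and> positive_solution T p q m g lam u2 \<and> (\<exists>x\<in>?I. u1 x \<noteq> u2 x)"
      if "lam < - L'" for lam
      using L'(2)[of "- lam"] that unfolding positive_solution_uminus_weight by simp
    then show ?thesis using L L'(1) by (intro exI[of _ L] exI[of _ "- L'"] conjI) auto
  qed
  obtain \<mu>1 where \<mu>1: "\<mu>1 > 0" "\<And>lam u. lam \<in> {0<..<\<mu>1} \<Longrightarrow> \<not> positive_solution T p q m f lam u"
    using no_positive_solution[OF assms(1-3) q assms(5,6,9) f_pos f0(1) small(1) large(1)] by blast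
  obtain \<mu>2 where \<mu>2: "\<mu>2 > 0" "\<And>lam u. lam \<in> {0<..<\<mu>2} \<Longrightarrow> \<not> positive_solution T p q m f' lam u"
    using no_positive_solution[OF assms(1-3) q assms(5,6) f'c f'_pos f0(2) small(2) large(2)] by blast
  have neg: "negative_solution T p q m f lam u \<longleftrightarrow> positive_solution T p q m f' lam (\<lambda>x. - u x)" for lam u
    unfolding f'_def by (rule negative_solution_reflect)
  have pos: "positive_solution T p q m f' lam u \<longleftrightarrow> negative_solution T p q m f lam (\<lambda>x. - u x)" for lam u
    unfolding neg by simp
  \<comment> \<open>The smaller of the thresholds for \<open>f\<close> and its reflection
    \<open>f'\<close> excludes both signs, and so serves for either value of
    \<open>\<nu>\<close>.\<close>
  have "\<not> one_sign_solution T p q m f lam u" if "lam \<in> {0<..<min \<mu>1 \<mu>2}" for lam u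
    using that \<mu>1(2)[of lam] \<mu>2(2)[of lam] by (auto simp: one_sign_solution_def neg)
  then have none: "\<exists>\<mu>>0. \<forall>lam\<in>{0<..<\<mu>}. \<not> (\<exists>u. one_sign_solution T p q m f lam u)"
    using \<mu>1(1) \<mu>2(1) by (intro exI[of _ "min \<mu>1 \<mu>2"]) auto
  have reflected: "\<exists>u1 u2. negative_solution T p q m f lam u1 \<and> negative_solution T p q m f lam u2 \<and> (\<exists>x\<in>?I. u1 x \<noteq> u2 x)"
    if "\<exists>u1 u2. positive_solution T p q m f' lam u1 \<and> positive_solution T p q m f' lam u2 \<and> (\<exists>x\<in>?I. u1 x \<noteq> u2 x)" for lam
    using that unfolding pos by (metis neg_equal_iff_equal)
  obtain lp lm where "lp > 0" "lm < 0" and "\<forall>lam\<in>{lp<..} \<union> {..<lm}.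
      \<exists>u1 u2. positive_solution T p q m f' lam u1 \<and> positive_solution T p q m f' lam u2 \<and> (\<exists>x\<in>?I. u1 x \<noteq> u2 x)"
    using both_signs[OF f'c f'_pos f0(2) small(2) large(2)] by auto
  then have negative: "\<exists>lp>0. \<exists>lm<0. \<forall>lam\<in>{lp<..} \<union> {..<lm}.
      \<exists>u1 u2. negative_solution T p q m f lam u1 \<and> negative_solution T p q m f lam u2 \<and> (\<exists>x\<in>?I. u1 x \<noteq> u2 x)"
    by (intro exI[of _ lp] exI[of _ lm] conjI ballI reflected) (simp_all only:)
  show ?thesis
    by (intro conjI ballI both_signs[OF assms(9) f_pos f0(1) small(1) large(1)] negative none)
qed

end
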